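(* Fix $M>0$ and a level $\alpha\in(0,1)$. Consider testing $H_0:P=P_0$ against $H_1: P\in\mathcal P(\Delta_n,0,M)$ by the test $T_{\mathrm{MMD}}$, based on $X_1,\dots,X_n$ i.i.d. from $P$. (i) If $\sqrt{n}\,\Delta_n\to\infty$, then $\beta(T_{\mathrm{MMD}};\Delta_n,0,M)\to 0$ as $n\to\infty$. (ii) Conversely, there exists a constant $c_0>0$ such that $\liminf_{n\to\infty}\beta(T_{\mathrm{MMD}};c_0 n^{-1/2},0,M)>0$.
   Context: Standing setup. $(\mathcal X,\mathcal B)$ is a measurable space and $P_0$ a known probability measure on it. $K:\mathcal X\times\mathcal X\to\mathbb R$ is a symmetric, positive semidefinite, square-integrable (w.r.t. $P_0\otimes P_0$) kernel which is degenerate under $P_0$, i.e. $\mathbb E_{P_0}K(X,\cdot)=0$. It has the Mercer decomposition $K(x,x')=\sum_{k\ge1}\lambda_k\varphi_k(x)\varphi_k(x')$ with infinitely many eigenvalues $\lambda_1>\lambda_2>\cdots>0$, where $\{\varphi_k\}_{k\ge1}$ is an orthonormal basis of the space of $P_0$-mean-zero functions in $L_2(P_0)$ (so $\mathbb E_{P_0}\varphi_k(X)=0$). Assume $0<\liminf_{k\to\infty}k^{2s}\lambda_k\le\limsup_{k\to\infty}k^{2s}\lambda_k<\infty$ for some $s>1/2$, and $\sup_{k\ge1}\|\varphi_k\|_\infty<\infty$. $\mathcal H(K)$ is the RKHS of $K$, with $\|f\|_K^2=\sum_k\lambda_k^{-1}\langle f,\varphi_k\rangle_{L_2(P_0)}^2$.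 For $\theta>0$, $M>0$, $\mathcal F(\theta;M)$ is the set of $f\in L_2(P_0)$ such that for every $R>0$ there is $f_R\in\mathcal H(K)$ with $\|f_R\|_K\le R$ and $\|f-f_R\|_{L_2(P_0)}\le MR^{-1/\theta}$; and $\mathcal F(0;M)=\{f\in\mathcal H(K):\|f\|_K\le M\}$. For $\Delta>0$, $\theta\ge0$, $\mathcal P(\Delta,\theta,M)$ is the set of probability measures $P\ll P_0$ on $(\mathcal X,\mathcal B)$ with $u:=dP/dP_0-1\in\mathcal F(\theta;M)$ and $\chi^2(P,P_0):=\|u\|_{L_2(P_0)}^2\ge\Delta$. For a test $T:\mathcal X^n\to[0,1]$, its type II error is $\beta(T;\Delta,\theta,M)=\sup_{P\in\mathcal P(\Delta,\theta,M)}\mathbb E_P[1-T(X_1,\dots,X_n)]$, with $X_1,\dots,X_n$ i.i.d. $P$. MMD test: $\gamma^2(\widehat P_n,P_0)=\sum_{k\ge1}\lambda_k\big[\frac1n\sum_{i=1}^n\varphi_k(X_i)\big]^2$; $W=\sum_{k\ge1}\lambda_kZ_k^2$ with $Z_k$ i.i.d. $N(0,1)$, and $q_{w,1-\alpha}$ is the upper $\alpha$ quantile of $W$; $T_{\mathrm{MMD}}=\mathbf 1\{n\gamma^2(\widehat P_n,P_0)>q_{w,1-\alpha}\}$. *)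

theory Defs
  imports "HOL-Probability.Probability"
begin

(* Indexing convention: the paper's eigenpairs (lambda_k, phi_k), k >= 1, are
   represented here by lam (k-1), phi (k-1), i.e. index k :: nat starts at 0. *)

definition L2 :: "'a measure \<Rightarrow> ('a \<Rightarrow> real) \<Rightarrow> bool" where
  "L2 P0 f \<longleftrightarrow> f \<in> borel_measurable P0 \<and> integrable P0 (\<lambda>x. (f x)\<^sup>2)"

definition coef :: "'a measure \<Rightarrow> (nat \<Rightarrow> 'a \<Rightarrow> real) \<Rightarrow> ('a \<Rightarrow> real) \<Rightarrow> nat \<Rightarrow> real" where
  "coef P0 phi f k = (\<integral>x. f x * phi k x \<partial>P0)"

(* membership in the RKHS H(K), viewed inside L2(P0): mean-zero L2 functions with
   finite RKHS norm sum_k lambda_k^{-1} <f,phi_k>^2 *)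
definition in_RKHS :: "'a measure \<Rightarrow> (nat \<Rightarrow> real) \<Rightarrow> (nat \<Rightarrow> 'a \<Rightarrow> real) \<Rightarrow> ('a \<Rightarrow> real) \<Rightarrow> bool" where
  "in_RKHS P0 lam phi f \<longleftrightarrow> L2 P0 f \<and> (\<integral>x. f x \<partial>P0) = 0 \<and>
     summable (\<lambda>k. (coef P0 phi f k)\<^sup>2 / lam k)"

definition RKHS_norm :: "'a measure \<Rightarrow> (nat \<Rightarrow> real) \<Rightarrow> (nat \<Rightarrow> 'a \<Rightarrow> real) \<Rightarrow> ('a \<Rightarrow> real) \<Rightarrow> real" where
  "RKHS_norm P0 lam phi f = sqrt (\<Sum>k. (coef P0 phi f k)\<^sup>2 / lam k)"

definition F0 :: "'a measure \<Rightarrow> (nat \<Rightarrow> real) \<Rightarrow> (nat \<Rightarrow> 'a \<Rightarrow> real) \<Rightarrow> real \<Rightarrow> ('a \<Rightarrow> real) set" where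
  "F0 P0 lam phi M = {f. in_RKHS P0 lam phi f \<and> RKHS_norm P0 lam phi f \<le> M}"

definition udens :: "'a measure \<Rightarrow> 'a measure \<Rightarrow> 'a \<Rightarrow> real" where
  "udens P0 P x = enn2real (RN_deriv P0 P x) - 1"

definition chi2 :: "'a measure \<Rightarrow> 'a measure \<Rightarrow> real" where
  "chi2 P P0 = (\<integral>x. (udens P0 P x)\<^sup>2 \<partial>P0)"

definition Palt :: "'a measure \<Rightarrow> (nat \<Rightarrow> real) \<Rightarrow> (nat \<Rightarrow> 'a \<Rightarrow> real) \<Rightarrow> real \<Rightarrow> real \<Rightarrow> 'a measure set" where
  "Palt P0 lam phi \<Delta> M = {P. prob_space P \<and> sets P = sets P0 \<and> absolutely_continuous P0 P \<and>
      udens P0 P \<in> F0 P0 lam phi M \<and> chi2 P P0 \<ge> \<Delta>}"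

definition mmd_sq :: "(nat \<Rightarrow> real) \<Rightarrow> (nat \<Rightarrow> 'a \<Rightarrow> real) \<Rightarrow> nat \<Rightarrow> (nat \<Rightarrow> 'a) \<Rightarrow> real" where
  "mmd_sq lam phi n x = (\<Sum>k. lam k * ((1 / real n) * (\<Sum>i<n. phi k (x i)))\<^sup>2)"

definition std_normal_distribution :: "real measure" where
  "std_normal_distribution = density lborel (\<lambda>x. ennreal (std_normal_density x))"

definition Zseq :: "(nat \<Rightarrow> real) measure" where
  "Zseq = PiM UNIV (\<lambda>_. std_normal_distribution)"

definition Wvar :: "(nat \<Rightarrow> real) \<Rightarrow> (nat \<Rightarrow> real) \<Rightarrow> real" where
  "Wvar lam z = (\<Sum>k. lam k * (z k)\<^sup>2)"

definition q_w :: "(nat \<Rightarrow> real) \<Rightarrow> real \<Rightarrow> real" where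
  "q_w lam \<alpha> = Inf {t. measure Zseq {z \<in> space Zseq. Wvar lam z \<le> t} \<ge> 1 - \<alpha>}"

definition T_MMD :: "(nat \<Rightarrow> real) \<Rightarrow> (nat \<Rightarrow> 'a \<Rightarrow> real) \<Rightarrow> real \<Rightarrow> nat \<Rightarrow> (nat \<Rightarrow> 'a) \<Rightarrow> real" where
  "T_MMD lam phi \<alpha> n x = (if real n * mmd_sq lam phi n x > q_w lam \<alpha> then 1 else 0)"

(* beta(T_MMD; Delta, 0, M) at sample size n; the supremum over the empty class is 0 *)
definition typeII :: "'a measure \<Rightarrow> (nat \<Rightarrow> real) \<Rightarrow> (nat \<Rightarrow> 'a \<Rightarrow> real) \<Rightarrow> real \<Rightarrow> real \<Rightarrow> real \<Rightarrow> nat \<Rightarrow> real" where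
  "typeII P0 lam phi \<alpha> \<Delta> M n =
     Sup (insert 0 ((\<lambda>P. \<integral>x. 1 - T_MMD lam phi \<alpha> n x \<partial>(PiM {..<n} (\<lambda>_. P))) ` Palt P0 lam phi \<Delta> M))"

end

theory Submission
  imports Defs "HOL-Real_Asymp.Real_Asymp"
begin

text \<open>
  Write \<open>a\<^sub>k = E\<^sub>P \<phi>\<^sub>k\<close> for the coefficients of \<open>u = dP/dP\<^sub>0 - 1\<close>.

  (i) Since \<open>\<Sum> a\<^sub>k\<^sup>2 / \<lambda>\<^sub>k \<le> M\<^sup>2\<close>, the Cauchy--Schwarz inequality gives \<open>\<Sum> \<lambda>\<^sub>k a\<^sub>k\<^sup>2 \<ge> \<Delta>\<^sup>2 / M\<^sup>2\<close>.
  Acceptance forces the fluctuation \<open>n \<Sum> \<lambda>\<^sub>k (mean of \<phi>\<^sub>k(X\<^sub>i) - a\<^sub>k)\<^sup>2\<close> to be of order \<open>n \<Delta>\<^sup>2 / M\<^sup>2\<close>, while its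
  expectation is bounded uniformly in \<open>P\<close>; Markov's inequality concludes.

  (ii) Take \<open>dP\<^sub>n/dP\<^sub>0 = 1 + a \<phi>\<^sub>\<kappa>\<close> with \<open>a\<^sup>2 = c n\<^sup>-\<^sup>1\<^sup>/\<^sup>2\<close> and \<open>\<lambda>\<^sub>\<kappa>\<close> of order \<open>c n\<^sup>-\<^sup>1\<^sup>/\<^sup>2 / M\<^sup>2\<close>,
  which adds only \<open>n \<lambda>\<^sub>\<kappa> a\<^sup>2 = O(c\<^sup>2)\<close> to the statistic \<open>T\<close>. The acceptance probability is bounded below
  through Laplace transforms, \<open>P(T \<le> q) \<ge> E exp (- \<tau> T) - exp (- \<tau> q)\<close>. Up to a small tail, \<open>E exp (- \<tau> T)\<close> converges to
  \<open>\<Prod> (1 + 2 \<tau> \<lambda>\<^sub>k)\<^sup>-\<^sup>1\<^sup>/\<^sup>2\<close>, and as \<open>\<Sum> \<lambda>\<^sub>k < \<infinity>\<close> this product exceeds \<open>exp (- \<tau> q)\<close> for large \<open>\<tau>\<close>.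
  So no multivariate central limit theorem is needed, and \<open>\<alpha>\<close> may be arbitrarily close to \<open>1\<close>.
\<close>

section \<open>Series and integrals\<close>

lemma
  fixes f g :: "nat \<Rightarrow> real"
  assumes f: "summable (\<lambda>k. (f k)\<^sup>2)" and g: "summable (\<lambda>k. (g k)\<^sup>2)"
  shows summable_abs_mult_of_squares: "summable (\<lambda>k. \<bar>f k * g k\<bar>)"
    and Cauchy_Schwarz_suminf: "(\<Sum>k. f k * g k)\<^sup>2 \<le> (\<Sum>k. (f k)\<^sup>2) * (\<Sum>k. (g k)\<^sup>2)"
proof -
  have "\<bar>f k * g k\<bar> \<le> (f k)\<^sup>2 + (g k)\<^sup>2" for k
    using sum_squares_bound[of "\<bar>f k\<bar>" "\<bar>g k\<bar>"]
      mult_nonneg_nonneg[OF abs_ge_zero abs_ge_zero, of "f k" "g k"]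
    unfolding abs_mult power2_abs by linarith
  then show abs_summable: "summable (\<lambda>k. \<bar>f k * g k\<bar>)"
    using summable_comparison_test[OF _ summable_add[OF f g], of "\<lambda>k. \<bar>f k * g k\<bar>"] by auto
  show "(\<Sum>k. f k * g k)\<^sup>2 \<le> (\<Sum>k. (f k)\<^sup>2) * (\<Sum>k. (g k)\<^sup>2)"
  proof (rule LIMSEQ_le)
    show "(\<lambda>n. (\<Sum>k<n. f k * g k)\<^sup>2) \<longlonglongrightarrow> (\<Sum>k. f k * g k)\<^sup>2"
      by (intro tendsto_power summable_LIMSEQ summable_rabs_cancel[OF abs_summable])
    show "(\<lambda>n. (\<Sum>k<n. (f k)\<^sup>2) * (\<Sum>k<n. (g k)\<^sup>2)) \<longlonglongrightarrow> (\<Sum>k. (f k)\<^sup>2) * (\<Sum>k. (g k)\<^sup>2)"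
      using f g by (intro tendsto_mult summable_LIMSEQ)
  qed (use Cauchy_Schwarz_ineq_sum in blast)
qed

lemma
  fixes f :: "nat \<Rightarrow> 'a \<Rightarrow> real"
  assumes int: "\<And>k. integrable M (f k)"
    and nonneg: "\<And>k x. x \<in> space M \<Longrightarrow> 0 \<le> f k x"
    and sum: "summable (\<lambda>k. \<integral>x. f k x \<partial>M)"
  shows AE_summable_of_summable_integral: "AE x in M. summable (\<lambda>k. f k x)"
    and integrable_suminf_nonneg: "integrable M (\<lambda>x. \<Sum>k. f k x)"
    and integral_suminf_nonneg: "(\<integral>x. (\<Sum>k. f k x) \<partial>M) = (\<Sum>k. \<integral>x. f k x \<partial>M)"
proof -
  have integral_nonneg: "0 \<le> (\<integral>x. f k x \<partial>M)" for k
    using nonneg by (intro integral_nonneg_AE) auto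
  have [measurable]: "f k \<in> borel_measurable M" for k
    using int by blast
  have "(\<integral>\<^sup>+x. (\<Sum>k. ennreal (f k x)) \<partial>M) = (\<Sum>k. \<integral>\<^sup>+x. ennreal (f k x) \<partial>M)"
    by (rule nn_integral_suminf) measurable
  also have "\<dots> = (\<Sum>k. ennreal (\<integral>x. f k x \<partial>M))"
    using int nonneg by (intro suminf_cong nn_integral_eq_integral) auto
  also have "\<dots> = ennreal (\<Sum>k. \<integral>x. f k x \<partial>M)"
    using sum integral_nonneg by (intro suminf_ennreal2) auto
  finally have "AE x in M. (\<Sum>k. ennreal (f k x)) \<noteq> \<infinity>"
    by (intro nn_integral_PInf_AE) auto
  then show AE_summable: "AE x in M. summable (\<lambda>k. f k x)"
    using AE_space
    by eventually_elim (use nonneg in \<open>auto intro!: summable_suminf_not_top\<close>)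
  have norm_summable: "AE x in M. summable (\<lambda>k. norm (f k x))"
    using AE_summable AE_space by eventually_elim (simp add: nonneg)
  have "(\<integral>x. norm (f k x) \<partial>M) = (\<integral>x. f k x \<partial>M)" for k
    using nonneg by (intro Bochner_Integration.integral_cong) auto
  then have norm_sum: "summable (\<lambda>k. \<integral>x. norm (f k x) \<partial>M)"
    using sum by simp
  show "integrable M (\<lambda>x. \<Sum>k. f k x)"
    by (rule integrable_suminf[OF int norm_summable norm_sum])
  show "(\<integral>x. (\<Sum>k. f k x) \<partial>M) = (\<Sum>k. \<integral>x. f k x \<partial>M)"
    by (rule integral_suminf[OF int norm_summable norm_sum])
qed

lemma integrable_mult_bounded:
  fixes f g :: "'a \<Rightarrow> real"
  assumes f: "integrable M f" and g[measurable]: "g \<in> borel_measurable M"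
    and bound: "\<And>x. x \<in> space M \<Longrightarrow> \<bar>g x\<bar> \<le> B"
  shows "integrable M (\<lambda>x. f x * g x)"
proof (rule Bochner_Integration.integrable_bound)
  show "integrable M (\<lambda>x. B * f x)"
    using f by simp
  show "AE x in M. norm (f x * g x) \<le> norm (B * f x)"
    using AE_space
  proof eventually_elim
    case (elim x)
    then have "\<bar>g x\<bar> \<le> \<bar>B\<bar>"
      using bound by force
    from mult_right_mono[OF this abs_ge_zero[of "f x"]] show ?case
      by (simp add: abs_mult mult.commute)
  qed
qed (use f in measurable)

lemma
  fixes f :: "'a \<Rightarrow> real" and g :: "nat \<Rightarrow> 'a \<Rightarrow> real"
  assumes f: "integrable M f" and g[measurable]: "\<And>k. g k \<in> borel_measurable M"
    and bound: "\<And>k x. x \<in> space M \<Longrightarrow> \<bar>g k x\<bar> \<le> B k" and B: "summable B"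
  shows integrable_mult_suminf_bounded: "integrable M (\<lambda>x. f x * (\<Sum>k. g k x))"
    and sums_integral_mult_bounded:
      "(\<lambda>k. \<integral>x. f x * g k x \<partial>M) sums (\<integral>x. f x * (\<Sum>k. g k x) \<partial>M)"
proof -
  have int: "integrable M (\<lambda>x. f x * g k x)" for k
    using bound by (intro integrable_mult_bounded[OF f g])
  have abs_summable: "summable (\<lambda>k. \<bar>g k x\<bar>)" if "x \<in> space M" for x
    using bound[OF that] by (intro summable_comparison_test[OF _ B]) auto
  have AE_summable: "AE x in M. summable (\<lambda>k. norm (f x * g k x))"
    by (intro AE_I2) (simp add: abs_mult summable_mult abs_summable)
  have integral_summable: "summable (\<lambda>k. \<integral>x. norm (f x * g k x) \<partial>M)"
  proof (rule summable_comparison_test[OF _ summable_mult2[OF B]], intro exI allI impI)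
    fix k
    have "(\<integral>x. norm (f x * g k x) \<partial>M) \<le> (\<integral>x. B k * \<bar>f x\<bar> \<partial>M)"
    proof (rule integral_mono)
      show "norm (f x * g k x) \<le> B k * \<bar>f x\<bar>" if "x \<in> space M" for x
        using mult_right_mono[OF bound[OF that, of k] abs_ge_zero[of "f x"]]
        by (simp add: abs_mult mult.commute)
    qed (use f int in auto)
    then show "norm (\<integral>x. norm (f x * g k x) \<partial>M) \<le> B k * (\<integral>x. \<bar>f x\<bar> \<partial>M)"
      by simp
  qed
  have suminf: "(\<Sum>k. f x * g k x) = f x * (\<Sum>k. g k x)" if "x \<in> space M" for x
    by (rule suminf_mult[OF summable_rabs_cancel[OF abs_summable[OF that]]])
  from integrable_suminf[OF int AE_summable integral_summable]
  show "integrable M (\<lambda>x. f x * (\<Sum>k. g k x))"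
    by (simp add: suminf cong: Bochner_Integration.integrable_cong)
  from sums_integral[OF int AE_summable integral_summable]
  show "(\<lambda>k. \<integral>x. f x * g k x \<partial>M) sums (\<integral>x. f x * (\<Sum>k. g k x) \<partial>M)"
    by (simp add: suminf cong: Bochner_Integration.integral_cong)
qed

section \<open>Second moments of i.i.d. sums\<close>

context prob_space
begin

lemma integrable_bounded:
  fixes f :: "'a \<Rightarrow> real"
  assumes "f \<in> borel_measurable M" "\<And>x. x \<in> space M \<Longrightarrow> \<bar>f x\<bar> \<le> B"
  shows "integrable M f"
  using assms by (intro integrable_const_bound[where B = B]) auto

lemma abs_expectation_le:
  fixes f :: "'a \<Rightarrow> real"
  assumes "f \<in> borel_measurable M" "\<And>x. x \<in> space M \<Longrightarrow> \<bar>f x\<bar> \<le> B"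
  shows "\<bar>expectation f\<bar> \<le> B"
proof -
  have "\<bar>expectation f\<bar> \<le> expectation (\<lambda>x. \<bar>f x\<bar>)"
    by (rule integral_abs_bound)
  also have "\<dots> \<le> B"
    using assms integrable_bounded[OF assms] by (intro integral_le_const) auto
  finally show ?thesis .
qed

lemma
  fixes f :: "'i \<Rightarrow> 'a \<Rightarrow> 'b :: {real_normed_field, banach, second_countable_topology}"
  assumes "finite I" "\<And>i. i \<in> I \<Longrightarrow> integrable M (f i)"
  shows integrable_PiM_prod: "integrable (PiM I (\<lambda>_. M)) (\<lambda>x. \<Prod>i\<in>I. f i (x i))"
    and integral_PiM_prod:
      "(\<integral>x. (\<Prod>i\<in>I. f i (x i)) \<partial>PiM I (\<lambda>_. M)) = (\<Prod>i\<in>I. \<integral>x. f i x \<partial>M)"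
proof -
  interpret product_sigma_finite "\<lambda>_. M" ..
  show "integrable (PiM I (\<lambda>_. M)) (\<lambda>x. \<Prod>i\<in>I. f i (x i))"
    using assms by (rule product_integrable_prod)
  show "(\<integral>x. (\<Prod>i\<in>I. f i (x i)) \<partial>PiM I (\<lambda>_. M)) = (\<Prod>i\<in>I. \<integral>x. f i x \<partial>M)"
    using assms by (rule product_integral_prod)
qed

lemma
  fixes g :: "'a \<Rightarrow> real"
  assumes g: "g \<in> borel_measurable M" "integrable M (\<lambda>x. (g x)\<^sup>2)"
    and I: "finite I" "i \<in> I" "j \<in> I"
  shows integrable_PiM_mult: "integrable (PiM I (\<lambda>_. M)) (\<lambda>x. g (x i) * g (x j))"
    and integral_PiM_mult: "(\<integral>x. g (x i) * g (x j) \<partial>PiM I (\<lambda>_. M)) =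
      (if i = j then expectation (\<lambda>x. (g x)\<^sup>2) else (expectation g)\<^sup>2)"
proof -
  define f where "f l y = (if l = i then g y else 1) * (if l = j then g y else 1)" for l y
  have g_int: "integrable M g"
    using g by (rule square_integrable_imp_integrable)
  have f_int: "integrable M (f l)" for l
    unfolding f_def using g g_int
    by (cases "l = i"; cases "l = j") (simp_all add: power2_eq_square)
  have prod_f: "(\<Prod>l\<in>I. f l (x l)) = g (x i) * g (x j)" for x
    using I by (simp add: f_def prod.distrib prod.delta)
  show "integrable (PiM I (\<lambda>_. M)) (\<lambda>x. g (x i) * g (x j))"
    using integrable_PiM_prod[OF I(1), of f] f_int by (simp add: prod_f)
  have "(\<integral>x. g (x i) * g (x j) \<partial>PiM I (\<lambda>_. M)) = (\<Prod>l\<in>I. expectation (f l))"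
    using integral_PiM_prod[OF I(1), of f] f_int by (simp add: prod_f)
  also have "\<dots> = (if i = j then expectation (\<lambda>x. (g x)\<^sup>2) else (expectation g)\<^sup>2)"
  proof (cases "i = j")
    case True
    have "expectation (f l) = (if l = i then expectation (\<lambda>x. (g x)\<^sup>2) else 1)" for l
      unfolding f_def using True by (cases "l = i") (simp_all add: power2_eq_square prob_space)
    then show ?thesis
      using I True by (simp add: prod.delta)
  next
    case False
    have "expectation (f l)
        = (if l = i then expectation g else 1) * (if l = j then expectation g else 1)" for l
      unfolding f_def using False by (cases "l = i"; cases "l = j") (simp_all add: prob_space)
    then show ?thesis
      using I False by (simp add: prod.distrib prod.delta power2_eq_square)
  qed
  finally show "(\<integral>x. g (x i) * g (x j) \<partial>PiM I (\<lambda>_. M)) =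
      (if i = j then expectation (\<lambda>x. (g x)\<^sup>2) else (expectation g)\<^sup>2)" .
qed

end

abbreviation iid :: "'a measure \<Rightarrow> nat \<Rightarrow> (nat \<Rightarrow> 'a) measure" where
  "iid P n \<equiv> PiM {..<n} (\<lambda>_. P)"

definition scaled_sum :: "('a \<Rightarrow> real) \<Rightarrow> nat \<Rightarrow> (nat \<Rightarrow> 'a) \<Rightarrow> real" where
  "scaled_sum g n x = (\<Sum>i<n. g (x i)) / sqrt (real n)"

lemma measurable_scaled_sum[measurable]:
  assumes [measurable]: "g \<in> borel_measurable P"
  shows "scaled_sum g n \<in> borel_measurable (iid P n)"
  unfolding scaled_sum_def[abs_def] by measurable

lemma scaled_sum_square_le:
  assumes bound: "\<And>y. y \<in> space P \<Longrightarrow> \<bar>g y\<bar> \<le> B" and x: "x \<in> space (iid P n)"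
  shows "(scaled_sum g n x)\<^sup>2 \<le> real n * B\<^sup>2"
proof -
  have "\<bar>\<Sum>i<n. g (x i)\<bar> \<le> (\<Sum>i<n. B)"
    using x by (intro order_trans[OF sum_abs] sum_mono bound) (auto simp: space_PiM)
  then have "(\<Sum>i<n. g (x i))\<^sup>2 \<le> (real n * B)\<^sup>2"
    using abs_le_square_iff[of "\<Sum>i<n. g (x i)" "real n * B"] by (simp add: abs_le_iff)
  then show ?thesis
    by (cases "n = 0") (simp_all add: scaled_sum_def field_simps power2_eq_square)
qed

lemma scaled_sum_shift:
  "scaled_sum (\<lambda>y. g y - c) n x = scaled_sum g n x - sqrt (real n) * c"
  by (cases "n = 0") (simp_all add: scaled_sum_def sum_subtractf field_simps)

context prob_space
begin

lemma integrable_scaled_sum_square: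
  fixes g :: "'a \<Rightarrow> real"
  assumes g: "g \<in> borel_measurable M" "integrable M (\<lambda>x. (g x)\<^sup>2)"
  shows "integrable (iid M n) (\<lambda>x. (scaled_sum g n x)\<^sup>2)"
proof -
  have "integrable (iid M n) (\<lambda>x. g (x i) * g (x j))" if "i < n" "j < n" for i j
    using that by (intro integrable_PiM_mult[OF g]) auto
  then have "integrable (iid M n) (\<lambda>x. (\<Sum>i<n. \<Sum>j<n. g (x i) * g (x j)) / real n)"
    by (intro integrable_divide_zero Bochner_Integration.integrable_sum) auto
  then show ?thesis
    by (simp add: scaled_sum_def power_divide power2_eq_square sum_product)
qed

lemma integral_scaled_sum_square:
  fixes g :: "'a \<Rightarrow> real"
  assumes g: "g \<in> borel_measurable M" "integrable M (\<lambda>x. (g x)\<^sup>2)" and n: "0 < n"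
  shows "(\<integral>x. (scaled_sum g n x)\<^sup>2 \<partial>iid M n) = variance g + real n * (expectation g)\<^sup>2"
proof -
  have int: "integrable (iid M n) (\<lambda>x. g (x i) * g (x j))" if "i < n" "j < n" for i j
    using that by (intro integrable_PiM_mult[OF g]) auto
  have "real n * (\<integral>x. (scaled_sum g n x)\<^sup>2 \<partial>iid M n) = (\<integral>x. (\<Sum>i<n. \<Sum>j<n. g (x i) * g (x j)) \<partial>iid M n)"
    using n by (simp add: scaled_sum_def power_divide power2_eq_square sum_product)
  also have "\<dots> = (\<Sum>i<n. \<Sum>j<n. \<integral>x. g (x i) * g (x j) \<partial>iid M n)"
    using int by (subst Bochner_Integration.integral_sum, force)
      (intro sum.cong refl Bochner_Integration.integral_sum, auto)
  also have "\<dots> = (\<Sum>i<n. \<Sum>j<n. (if i = j then variance g else 0) + (expectation g)\<^sup>2)"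
    using variance_eq[OF square_integrable_imp_integrable[OF g] g(2)]
    by (intro sum.cong refl) (auto simp: integral_PiM_mult[OF g])
  also have "\<dots> = real n * (variance g + real n * (expectation g)\<^sup>2)"
    by (simp add: sum.distrib algebra_simps)
  finally show ?thesis
    using n by simp
qed

lemma
  fixes g :: "'a \<Rightarrow> real"
  assumes g[measurable]: "g \<in> borel_measurable M" and bound: "\<And>x. x \<in> space M \<Longrightarrow> \<bar>g x\<bar> \<le> B"
  shows integrable_scaled_sum_square_bounded: "integrable (iid M n) (\<lambda>x. (scaled_sum g n x)\<^sup>2)"
    and integral_scaled_sum_square_le:
      "(\<integral>x. (scaled_sum g n x)\<^sup>2 \<partial>iid M n) \<le> B\<^sup>2 + real n * (expectation g)\<^sup>2"
proof -
  have square_bound: "\<bar>(g x)\<^sup>2\<bar> \<le> B\<^sup>2" if "x \<in> space M" for x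
    using power_mono[OF bound[OF that] abs_ge_zero, of 2] by simp
  have square_int: "integrable M (\<lambda>x. (g x)\<^sup>2)"
    by (rule integrable_bounded[OF _ square_bound]) measurable
  then show "integrable (iid M n) (\<lambda>x. (scaled_sum g n x)\<^sup>2)"
    by (rule integrable_scaled_sum_square[OF g])
  have "variance g \<le> expectation (\<lambda>x. (g x)\<^sup>2)"
    using variance_eq[OF integrable_bounded[OF g bound] square_int] by simp
  also have "\<dots> \<le> B\<^sup>2"
    using square_bound by (intro integral_le_const square_int) auto
  finally show "(\<integral>x. (scaled_sum g n x)\<^sup>2 \<partial>iid M n) \<le> B\<^sup>2 + real n * (expectation g)\<^sup>2"
    using integral_scaled_sum_square[OF g square_int, of n]
    by (cases "n = 0") (simp_all add: scaled_sum_def)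
qed

end

text \<open>\<open>n\<close> times the V-statistic of the kernel \<open>\<Sum>\<^sub>k w\<^sub>k g\<^sub>k(x) g\<^sub>k(x')\<close>.\<close>
definition V_statistic :: "(nat \<Rightarrow> real) \<Rightarrow> (nat \<Rightarrow> 'a \<Rightarrow> real) \<Rightarrow> nat \<Rightarrow> (nat \<Rightarrow> 'a) \<Rightarrow> real" where
  "V_statistic w g n x = (\<Sum>k. w k * (scaled_sum (g k) n x)\<^sup>2)"

lemma V_statistic_split:
  assumes "summable (\<lambda>k. w k * (scaled_sum (g k) n x)\<^sup>2)"
  shows "V_statistic w g n x = (\<Sum>k<N. w k * (scaled_sum (g k) n x)\<^sup>2)
    + V_statistic (\<lambda>k. w (k + N)) (\<lambda>k. g (k + N)) n x"
  unfolding V_statistic_def using suminf_split_initial_segment[OF assms, of N] by simp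

lemma V_statistic_shift_le:
  assumes w: "\<And>k. 0 \<le> w k"
    and summable: "summable (\<lambda>k. w k * (scaled_sum (g k) n x)\<^sup>2)"
      "summable (\<lambda>k. w k * (scaled_sum (\<lambda>y. g k y - c k) n x)\<^sup>2)" "summable (\<lambda>k. w k * (c k)\<^sup>2)"
  shows "real n * (\<Sum>k. w k * (c k)\<^sup>2)
    \<le> 2 * (V_statistic w g n x + V_statistic w (\<lambda>k y. g k y - c k) n x)"
proof -
  let ?S = "\<lambda>k. scaled_sum (g k) n x" and ?S' = "\<lambda>k. scaled_sum (\<lambda>y. g k y - c k) n x"
  have termwise: "real n * (w k * (c k)\<^sup>2) \<le> 2 * (w k * (?S k)\<^sup>2 + w k * (?S' k)\<^sup>2)" for k
  proof -
    have "real n * (c k)\<^sup>2 = (?S k - ?S' k)\<^sup>2"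
      by (simp add: scaled_sum_shift power_mult_distrib)
    also have "\<dots> \<le> 2 * ((?S k)\<^sup>2 + (?S' k)\<^sup>2)"
      using sum_squares_bound[of "?S k" "- ?S' k"] by (simp add: power2_diff)
    finally show ?thesis
      using mult_left_mono[OF _ w[of k]] by (fastforce simp: algebra_simps)
  qed
  have "real n * (\<Sum>k. w k * (c k)\<^sup>2) = (\<Sum>k. real n * (w k * (c k)\<^sup>2))"
    by (rule suminf_mult[OF summable(3), symmetric])
  also have "\<dots> \<le> (\<Sum>k. 2 * (w k * (?S k)\<^sup>2 + w k * (?S' k)\<^sup>2))"
    using summable by (intro suminf_le termwise summable_mult summable_add)
  also have "\<dots> = 2 * (V_statistic w g n x + V_statistic w (\<lambda>k y. g k y - c k) n x)"
    unfolding V_statistic_def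
    by (simp only: suminf_mult[OF summable_add[OF summable(1,2)]] suminf_add[OF summable(1,2)])
  finally show ?thesis .
qed

context prob_space
begin

context
  fixes w :: "nat \<Rightarrow> real" and g :: "nat \<Rightarrow> 'a \<Rightarrow> real" and B :: real
  assumes w: "\<And>k. 0 \<le> w k" "summable w"
    and g[measurable]: "\<And>k. g k \<in> borel_measurable M"
    and g_bound: "\<And>k x. x \<in> space M \<Longrightarrow> \<bar>g k x\<bar> \<le> B"
begin

lemma summable_V_statistic:
  assumes "x \<in> space (iid M n)"
  shows "summable (\<lambda>k. w k * (scaled_sum (g k) n x)\<^sup>2)"
proof (rule summable_comparison_test)
  show "summable (\<lambda>k. w k * (real n * B\<^sup>2))"
    by (rule summable_mult2[OF w(2)])
  show "\<exists>N. \<forall>k\<ge>N. norm (w k * (scaled_sum (g k) n x)\<^sup>2) \<le> w k * (real n * B\<^sup>2)"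
    using w(1) scaled_sum_square_le[OF g_bound assms] by (auto simp: abs_mult intro!: mult_left_mono)
qed

lemma V_statistic_nonneg: "x \<in> space (iid M n) \<Longrightarrow> 0 \<le> V_statistic w g n x"
  unfolding V_statistic_def using w(1) by (intro suminf_nonneg summable_V_statistic) auto

lemma summable_mult_expectation_square: "summable (\<lambda>k. w k * (expectation (g k))\<^sup>2)"
proof (rule summable_comparison_test)
  show "summable (\<lambda>k. w k * B\<^sup>2)"
    by (rule summable_mult2[OF w(2)])
  have "(expectation (g k))\<^sup>2 \<le> B\<^sup>2" for k
    using abs_expectation_le[OF g g_bound, of k] by (simp add: abs_le_square_iff[symmetric])
  then show "\<exists>N. \<forall>k\<ge>N. norm (w k * (expectation (g k))\<^sup>2) \<le> w k * B\<^sup>2"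
    using w(1) by (auto simp: abs_mult intro!: mult_left_mono)
qed

lemma
  shows integrable_V_statistic: "integrable (iid M n) (V_statistic w g n)"
    and integral_V_statistic_le: "(\<integral>x. V_statistic w g n x \<partial>iid M n)
      \<le> B\<^sup>2 * suminf w + real n * (\<Sum>k. w k * (expectation (g k))\<^sup>2)"
proof -
  let ?summand = "\<lambda>k x. w k * (scaled_sum (g k) n x)\<^sup>2"
  let ?bound = "\<lambda>k. w k * B\<^sup>2 + real n * (w k * (expectation (g k))\<^sup>2)"
  have summand_int: "integrable (iid M n) (?summand k)" for k
    using integrable_scaled_sum_square_bounded[OF g g_bound] by simp
  have summand_le: "(\<integral>x. ?summand k x \<partial>iid M n) \<le> ?bound k" for k
    using mult_left_mono[OF integral_scaled_sum_square_le[OF g g_bound] w(1)[of k]]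
    by (simp add: algebra_simps)
  note summands = summable_mult2[OF w(2)] summable_mult[OF summable_mult_expectation_square]
  have bound_summable: "summable ?bound"
    by (intro summable_add summands)
  have "0 \<le> (\<integral>x. ?summand k x \<partial>iid M n)" for k
    using w(1) by simp
  then have integral_summable: "summable (\<lambda>k. \<integral>x. ?summand k x \<partial>iid M n)"
    using summand_le by (intro summable_comparison_test[OF _ bound_summable]) auto
  show "integrable (iid M n) (V_statistic w g n)"
    unfolding V_statistic_def[abs_def] using w(1)
    by (intro integrable_suminf_nonneg summand_int integral_summable) auto
  have "(\<integral>x. V_statistic w g n x \<partial>iid M n) = (\<Sum>k. \<integral>x. ?summand k x \<partial>iid M n)"
    unfolding V_statistic_def using w(1)
    by (intro integral_suminf_nonneg summand_int integral_summable) auto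
  also have "\<dots> \<le> suminf ?bound"
    by (intro suminf_le summand_le integral_summable bound_summable)
  also have "\<dots> = B\<^sup>2 * suminf w + real n * (\<Sum>k. w k * (expectation (g k))\<^sup>2)"
    by (simp add: suminf_add[OF summands, symmetric] suminf_mult2[OF w(2), symmetric]
        suminf_mult[OF summable_mult_expectation_square] mult.commute)
  finally show "(\<integral>x. V_statistic w g n x \<partial>iid M n)
      \<le> B\<^sup>2 * suminf w + real n * (\<Sum>k. w k * (expectation (g k))\<^sup>2)" .
qed

end

end

section \<open>Laplace transforms of sums of squares\<close>

lemma real_distribution_std_normal: "real_distribution std_normal_distribution"
  using real_dist_normal_dist by (simp add: std_normal_distribution_def)

interpretation std_normal: real_distribution std_normal_distribution
  by (rule real_distribution_std_normal)

lemma integral_std_normal_iexp: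
  "(\<integral>z. iexp (t * z) \<partial>std_normal_distribution) = of_real (exp (- t\<^sup>2 / 2))"
  using char_std_normal_distribution[THEN fun_cong, of t]
  by (simp add: char_def std_normal_distribution_def)

lemma integral_std_normal_exp_neg_square:
  assumes "0 \<le> c"
  shows "(\<integral>z. exp (- (c * z\<^sup>2)) \<partial>std_normal_distribution) = 1 / sqrt (1 + 2 * c)"
proof -
  define \<sigma> where "\<sigma> = 1 / sqrt (1 + 2 * c)"
  have \<sigma>: "0 < \<sigma>" "\<sigma>\<^sup>2 = 1 / (1 + 2 * c)"
    using assms by (auto simp: \<sigma>_def power_divide)
  have rescaled: "std_normal_density z * exp (- (c * z\<^sup>2)) = \<sigma> * normal_density 0 \<sigma> z" for z
  proof -
    have "- (z\<^sup>2 / 2) - c * z\<^sup>2 = - z\<^sup>2 / (2 * \<sigma>\<^sup>2)"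
      using assms unfolding \<sigma>(2) by (simp add: field_simps)
    moreover have "sqrt (2 * pi * \<sigma>\<^sup>2) = sqrt (2 * pi) * \<sigma>"
      using \<sigma>(1) by (simp add: real_sqrt_mult)
    ultimately show ?thesis
      using \<sigma>(1) by (simp add: normal_density_def exp_add[symmetric] field_simps)
  qed
  have "(\<integral>z. exp (- (c * z\<^sup>2)) \<partial>std_normal_distribution)
      = (\<integral>z. std_normal_density z * exp (- (c * z\<^sup>2)) \<partial>lborel)"
    unfolding std_normal_distribution_def by (subst integral_density) auto
  also have "\<dots> = \<sigma>"
    unfolding rescaled using \<sigma>(1) by simp
  finally show ?thesis
    by (simp add: \<sigma>_def)
qed

abbreviation std_normal_vector :: "'i set \<Rightarrow> ('i \<Rightarrow> real) measure" where
  "std_normal_vector I \<equiv> PiM I (\<lambda>_. std_normal_distribution)"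

lemma prob_space_std_normal_vector: "prob_space (std_normal_vector I)"
  by (intro prob_space_PiM std_normal.prob_space_axioms)

lemma integral_std_normal_vector_iexp:
  assumes "finite I"
  shows "(\<integral>z. iexp (\<Sum>k\<in>I. b k * z k) \<partial>std_normal_vector I) = of_real (exp (- (\<Sum>k\<in>I. (b k)\<^sup>2) / 2))"
proof -
  have "(\<integral>z. iexp (\<Sum>k\<in>I. b k * z k) \<partial>std_normal_vector I)
      = (\<integral>z. (\<Prod>k\<in>I. iexp (b k * z k)) \<partial>std_normal_vector I)"
    using assms by (simp add: exp_sum sum_distrib_left)
  also have "\<dots> = (\<Prod>k\<in>I. \<integral>z. iexp (b k * z) \<partial>std_normal_distribution)"
    using assms
    by (intro std_normal.integral_PiM_prod std_normal.integrable_const_bound[where B = 1]) auto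
  also have "\<dots> = of_real (exp (- (\<Sum>k\<in>I. (b k)\<^sup>2) / 2))"
    unfolding integral_std_normal_iexp using assms
    by (simp add: exp_sum[symmetric] sum_divide_distrib sum_negf flip: of_real_prod)
  finally show ?thesis .
qed

lemma integral_std_normal_vector_exp_neg_squares:
  assumes I: "finite I" and c: "\<And>k. 0 \<le> c k"
  shows "(\<integral>z. exp (- (\<Sum>k\<in>I. c k * (z k)\<^sup>2)) \<partial>std_normal_vector I) = (\<Prod>k\<in>I. 1 / sqrt (1 + 2 * c k))"
proof -
  have "(\<integral>z. exp (- (\<Sum>k\<in>I. c k * (z k)\<^sup>2)) \<partial>std_normal_vector I)
      = (\<integral>z. (\<Prod>k\<in>I. exp (- (c k * (z k)\<^sup>2))) \<partial>std_normal_vector I)"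
    using I by (simp add: exp_sum[symmetric] sum_negf)
  also have "\<dots> = (\<Prod>k\<in>I. \<integral>z. exp (- (c k * z\<^sup>2)) \<partial>std_normal_distribution)"
    using I c
    by (intro std_normal.integral_PiM_prod std_normal.integrable_const_bound[where B = 1]) auto
  finally show ?thesis
    by (simp only: integral_std_normal_exp_neg_square[OF c])
qed

text \<open>Gaussian linearisation: a square in the exponent is the characteristic function of a standard
  normal variable, evaluated at the random point \<open>Y k x\<close>.\<close>
lemma (in prob_space) laplace_sum_squares_eq_integral_char:
  fixes Y :: "'i \<Rightarrow> 'a \<Rightarrow> real"
  assumes I: "finite I" and Y[measurable]: "\<And>k. Y k \<in> borel_measurable M"
  shows "complex_of_real (\<integral>x. exp (- (\<Sum>k\<in>I. (Y k x)\<^sup>2) / 2) \<partial>M)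
    = (\<integral>z. (\<integral>x. iexp (\<Sum>k\<in>I. z k * Y k x) \<partial>M) \<partial>std_normal_vector I)"
proof -
  interpret Z: prob_space "std_normal_vector I"
    by (rule prob_space_std_normal_vector)
  interpret MZ: pair_prob_space M "std_normal_vector I" ..
  let ?e = "\<lambda>x z. iexp (\<Sum>k\<in>I. z k * Y k x)"
  have "(\<lambda>(x, z). ?e x z) \<in> borel_measurable (M \<Otimes>\<^sub>M std_normal_vector I)"
    by measurable
  then have int: "integrable (M \<Otimes>\<^sub>M std_normal_vector I) (\<lambda>(x, z). ?e x z)"
    by (rule MZ.P.integrable_const_bound[where B = 1, rotated]) (auto intro!: AE_I2)
  have "complex_of_real (\<integral>x. exp (- (\<Sum>k\<in>I. (Y k x)\<^sup>2) / 2) \<partial>M)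
      = (\<integral>x. complex_of_real (exp (- (\<Sum>k\<in>I. (Y k x)\<^sup>2) / 2)) \<partial>M)"
    by (rule integral_complex_of_real[symmetric])
  also have "\<dots> = (\<integral>x. (\<integral>z. ?e x z \<partial>std_normal_vector I) \<partial>M)"
    by (simp only: integral_std_normal_vector_iexp[OF I, symmetric] mult.commute)
  also have "\<dots> = (\<integral>z. (\<integral>x. ?e x z \<partial>M) \<partial>std_normal_vector I)"
    by (rule MZ.Fubini_integral[OF int, symmetric])
  finally show ?thesis .
qed

lemma laplace_sum_squares_tendsto:
  fixes Q :: "nat \<Rightarrow> 'a measure" and Y :: "nat \<Rightarrow> 'i \<Rightarrow> 'a \<Rightarrow> real"
  assumes I: "finite I" and Q: "\<And>n. prob_space (Q n)"
    and Y[measurable]: "\<And>n k. Y n k \<in> borel_measurable (Q n)" and v: "\<And>k. 0 \<le> v k"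
    and char: "\<And>b. (\<lambda>n. \<integral>x. iexp (\<Sum>k\<in>I. b k * Y n k x) \<partial>Q n)
      \<longlonglongrightarrow> of_real (exp (- (\<Sum>k\<in>I. v k * (b k)\<^sup>2) / 2))"
  shows "(\<lambda>n. \<integral>x. exp (- (\<Sum>k\<in>I. (Y n k x)\<^sup>2) / 2) \<partial>Q n) \<longlonglongrightarrow> (\<Prod>k\<in>I. 1 / sqrt (1 + v k))"
    (is "?L \<longlonglongrightarrow> _")
proof -
  interpret Z: prob_space "std_normal_vector I"
    by (rule prob_space_std_normal_vector)
  let ?\<phi> = "\<lambda>n z. \<integral>x. iexp (\<Sum>k\<in>I. z k * Y n k x) \<partial>Q n"
  have "(\<lambda>n. \<integral>z. ?\<phi> n z \<partial>std_normal_vector I)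
      \<longlonglongrightarrow> (\<integral>z. complex_of_real (exp (- (\<Sum>k\<in>I. v k * (z k)\<^sup>2) / 2)) \<partial>std_normal_vector I)"
  proof (rule integral_dominated_convergence[where w = "\<lambda>_. 1"])
    fix n
    interpret prob_space "Q n" by (rule Q)
    show "?\<phi> n \<in> borel_measurable (std_normal_vector I)"
      by measurable
    have "norm (?\<phi> n z) \<le> (\<integral>x. norm (iexp (\<Sum>k\<in>I. z k * Y n k x)) \<partial>Q n)" for z
      by (rule integral_norm_bound)
    then show "AE z in std_normal_vector I. norm (?\<phi> n z) \<le> 1"
      by (simp add: prob_space)
  qed (use char in auto)
  moreover have "(\<integral>z. ?\<phi> n z \<partial>std_normal_vector I) = complex_of_real (?L n)" for n
    by (rule prob_space.laplace_sum_squares_eq_integral_char[OF Q I Y, symmetric])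
  moreover have "(\<integral>z. exp (- (\<Sum>k\<in>I. v k * (z k)\<^sup>2) / 2) \<partial>std_normal_vector I)
      = (\<Prod>k\<in>I. 1 / sqrt (1 + v k))"
    using integral_std_normal_vector_exp_neg_squares[OF I, of "\<lambda>k. v k / 2"] v
    by (simp add: sum_divide_distrib)
  ultimately show ?thesis
    by (simp only: integral_complex_of_real tendsto_of_real_iff)
qed

context prob_space
begin

lemma laplace_minus_exp_le_prob:
  fixes X :: "'a \<Rightarrow> real"
  assumes X[measurable]: "X \<in> borel_measurable M" and nonneg: "\<And>x. x \<in> space M \<Longrightarrow> 0 \<le> X x"
    and \<tau>: "0 \<le> \<tau>"
  shows "expectation (\<lambda>x. exp (- (\<tau> * X x))) - exp (- (\<tau> * q)) \<le> prob {x \<in> space M. X x \<le> q}"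
proof -
  let ?A = "{x \<in> space M. X x \<le> q}"
  have A_int: "integrable M (indicator ?A :: 'a \<Rightarrow> real)"
    by (intro integrable_real_indicator) (auto simp: less_top[symmetric])
  have "expectation (\<lambda>x. exp (- (\<tau> * X x))) \<le> expectation (\<lambda>x. indicator ?A x + exp (- (\<tau> * q)))"
  proof (rule integral_mono)
    show "integrable M (\<lambda>x. exp (- (\<tau> * X x)))"
      using nonneg \<tau> by (intro integrable_bounded[where B = 1]) auto
    fix x assume x: "x \<in> space M"
    show "exp (- (\<tau> * X x)) \<le> indicator ?A x + exp (- (\<tau> * q))"
    proof (cases "X x \<le> q")
      case True
      have "exp (- (\<tau> * X x)) \<le> 1"
        using nonneg[OF x] \<tau> by simp
      then show ?thesis
        using True x by (simp add: add_increasing2)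
    next
      case False
      then show ?thesis
        using \<tau> by (simp add: mult_left_mono)
    qed
  qed (simp add: A_int)
  also have "\<dots> = prob ?A + exp (- (\<tau> * q))"
    by (simp add: A_int prob_space Int_absorb1)
  finally show ?thesis
    by simp
qed

lemma laplace_add_ge:
  fixes X Y :: "'a \<Rightarrow> real"
  assumes X[measurable]: "X \<in> borel_measurable M" and Y: "integrable M Y"
    and nonneg: "\<And>x. x \<in> space M \<Longrightarrow> 0 \<le> X x" "\<And>x. x \<in> space M \<Longrightarrow> 0 \<le> Y x" and \<tau>: "0 \<le> \<tau>"
  shows "expectation (\<lambda>x. exp (- (\<tau> * X x))) - \<tau> * expectation Y
    \<le> expectation (\<lambda>x. exp (- (\<tau> * (X x + Y x))))"
proof -
  have [measurable]: "Y \<in> borel_measurable M"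
    using Y by simp
  have X_int: "integrable M (\<lambda>x. exp (- (\<tau> * X x)))"
    using nonneg(1) \<tau> by (intro integrable_bounded[where B = 1]) auto
  have "expectation (\<lambda>x. exp (- (\<tau> * X x)) - \<tau> * Y x) \<le> expectation (\<lambda>x. exp (- (\<tau> * (X x + Y x))))"
  proof (rule integral_mono)
    show "integrable M (\<lambda>x. exp (- (\<tau> * (X x + Y x))))"
      using nonneg \<tau> by (intro integrable_bounded[where B = 1]) auto
    fix x assume x: "x \<in> space M"
    have "exp (- (\<tau> * X x)) * (\<tau> * Y x) \<le> 1 * (\<tau> * Y x)"
      using nonneg[OF x] \<tau> by (intro mult_right_mono) auto
    moreover have "exp (- (\<tau> * X x)) * (1 - \<tau> * Y x) \<le> exp (- (\<tau> * X x)) * exp (- (\<tau> * Y x))"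
      using exp_ge_add_one_self[of "- (\<tau> * Y x)"] by (intro mult_left_mono) auto
    ultimately show "exp (- (\<tau> * X x)) - \<tau> * Y x \<le> exp (- (\<tau> * (X x + Y x)))"
      by (simp add: exp_add[symmetric] algebra_simps)
  qed (use X_int Y in auto)
  then show ?thesis
    using X_int Y by simp
qed

end

section \<open>Central limit theorem for bounded triangular arrays\<close>

context prob_space
begin

lemma integral_iexp_scaled_sum:
  fixes h :: "'a \<Rightarrow> real"
  assumes h[measurable]: "h \<in> borel_measurable M"
  shows "(\<integral>x. iexp (scaled_sum h n x) \<partial>iid M n) = (char (distr M borel h) (1 / sqrt (real n))) ^ n"
proof -
  have "(\<integral>x. iexp (scaled_sum h n x) \<partial>iid M n)
      = (\<integral>x. (\<Prod>i<n. iexp (1 / sqrt (real n) * h (x i))) \<partial>iid M n)"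
    by (simp add: scaled_sum_def exp_sum sum_distrib_left sum_divide_distrib)
  also have "\<dots> = (\<Prod>i<n. \<integral>x. iexp (1 / sqrt (real n) * h x) \<partial>M)"
    by (intro integral_PiM_prod integrable_const_bound[where B = 1]) auto
  also have "\<dots> = (char (distr M borel h) (1 / sqrt (real n))) ^ n"
    unfolding char_def by (subst integral_distr) auto
  finally show ?thesis .
qed

lemma char_bounded_approx:
  fixes h :: "'a \<Rightarrow> real"
  assumes h[measurable]: "h \<in> borel_measurable M" and bound: "\<And>x. x \<in> space M \<Longrightarrow> \<bar>h x\<bar> \<le> B"
    and mean: "expectation h = 0"
  shows "cmod (char (distr M borel h) t - of_real (1 - t\<^sup>2 * expectation (\<lambda>x. (h x)\<^sup>2) / 2))
    \<le> \<bar>t\<bar> ^ 3 * B ^ 3 / 6"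
proof -
  have power_bound: "\<bar>h x\<bar> ^ k \<le> B ^ k" if "x \<in> space M" for x k
    using bound[OF that] by (intro power_mono) auto
  have square_int: "integrable M (\<lambda>x. (h x)\<^sup>2)"
    using power_bound[of _ 2] by (intro integrable_bounded[where B = "B\<^sup>2"]) auto
  have cube_int: "integrable M (\<lambda>x. \<bar>t\<bar> * \<bar>h x\<bar> ^ 3)"
    using power_bound[of _ 3] by (intro integrable_mult_right integrable_bounded[where B = "B ^ 3"]) auto
  have "variance h = expectation (\<lambda>x. (h x)\<^sup>2)"
    by (simp add: mean)
  note char_approx3'[OF h integrable_bounded[OF h bound] square_int mean this refl, of t]
  also have "t\<^sup>2 / 6 * expectation (\<lambda>x. min (6 * (h x)\<^sup>2) (\<bar>t\<bar> * \<bar>h x\<bar> ^ 3)) \<le> t\<^sup>2 / 6 * (\<bar>t\<bar> * B ^ 3)"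
    using power_bound[of _ 3] square_int cube_int
    by (intro mult_left_mono integral_le_const integrable_min)
      (auto intro!: min.coboundedI2 mult_left_mono)
  also have "\<dots> = \<bar>t\<bar> ^ 3 * B ^ 3 / 6"
    by (simp add: power3_eq_cube power2_eq_square)
  finally show ?thesis
    by simp
qed

lemma integral_iexp_scaled_sum_approx:
  fixes h :: "'a \<Rightarrow> real"
  assumes h[measurable]: "h \<in> borel_measurable M" and bound: "\<And>x. x \<in> space M \<Longrightarrow> \<bar>h x\<bar> \<le> B"
    and mean: "expectation h = 0" and n: "0 < n" and v: "0 \<le> v" "v \<le> 4 * real n"
  shows "cmod ((\<integral>x. iexp (scaled_sum h n x) \<partial>iid M n) - of_real ((1 - v / 2 / real n) ^ n))
    \<le> B ^ 3 / (6 * sqrt (real n)) + \<bar>expectation (\<lambda>x. (h x)\<^sup>2) - v\<bar> / 2"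
proof -
  define \<sigma> where "\<sigma> = expectation (\<lambda>x. (h x)\<^sup>2)"
  let ?\<phi> = "char (distr M borel h) (1 / sqrt (real n))"
  interpret D: real_distribution "distr M borel h"
    by (intro real_distribution_distr) auto
  have "1 - v / 2 / real n = 1 - (1 / sqrt (real n))\<^sup>2 * \<sigma> / 2 - (v - \<sigma>) / (2 * real n)"
    by (simp add: power_divide diff_divide_distrib)
  then have "?\<phi> - of_real (1 - v / 2 / real n)
      = (?\<phi> - of_real (1 - (1 / sqrt (real n))\<^sup>2 * \<sigma> / 2)) + of_real ((v - \<sigma>) / (2 * real n))"
    by (simp only: of_real_diff diff_diff_eq2 add_diff_eq diff_add_eq add_ac)
  then have "cmod (?\<phi> - of_real (1 - v / 2 / real n))
      \<le> cmod (?\<phi> - of_real (1 - (1 / sqrt (real n))\<^sup>2 * \<sigma> / 2))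
        + cmod (of_real ((v - \<sigma>) / (2 * real n)))"
    by (metis norm_triangle_ineq)
  also have "cmod (of_real ((v - \<sigma>) / (2 * real n))) = \<bar>\<sigma> - v\<bar> / (2 * real n)"
    by (simp only: norm_of_real) (simp add: abs_minus_commute)
  also have "cmod (?\<phi> - of_real (1 - (1 / sqrt (real n))\<^sup>2 * \<sigma> / 2))
      \<le> \<bar>1 / sqrt (real n)\<bar> ^ 3 * B ^ 3 / 6"
    unfolding \<sigma>_def by (rule char_bounded_approx[OF h bound mean])
  finally have "real n * cmod (?\<phi> - of_real (1 - v / 2 / real n))
      \<le> real n * (\<bar>1 / sqrt (real n)\<bar> ^ 3 * B ^ 3 / 6 + \<bar>\<sigma> - v\<bar> / (2 * real n))"
    by (intro mult_left_mono) auto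
  also have "\<dots> = B ^ 3 / (6 * sqrt (real n)) + \<bar>\<sigma> - v\<bar> / 2"
    using n by (simp add: field_simps power3_eq_cube)
  moreover have "norm (?\<phi> ^ n - of_real (1 - v / 2 / real n) ^ n)
      \<le> real n * cmod (?\<phi> - of_real (1 - v / 2 / real n))"
    using v n by (intro norm_power_diff D.cmod_char_le_1)
      (simp only: norm_of_real, auto simp: abs_le_iff field_simps)
  ultimately show ?thesis
    by (simp add: integral_iexp_scaled_sum[OF h] \<sigma>_def)
qed

end

lemma integral_iexp_scaled_sum_tendsto:
  fixes Q :: "nat \<Rightarrow> 'a measure" and h :: "'a \<Rightarrow> real"
  assumes Q: "\<And>n. prob_space (Q n)" and h: "\<And>n. h \<in> borel_measurable (Q n)"
    and bound: "\<And>n x. x \<in> space (Q n) \<Longrightarrow> \<bar>h x\<bar> \<le> B"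
    and mean: "\<forall>\<^sub>F n in sequentially. (\<integral>x. h x \<partial>Q n) = 0"
    and square: "(\<lambda>n. \<integral>x. (h x)\<^sup>2 \<partial>Q n) \<longlonglongrightarrow> v"
  shows "(\<lambda>n. \<integral>x. iexp (scaled_sum h n x) \<partial>iid (Q n) n) \<longlonglongrightarrow> of_real (exp (- v / 2))"
proof -
  let ?\<phi> = "\<lambda>n. \<integral>x. iexp (scaled_sum h n x) \<partial>iid (Q n) n"
  let ?e = "\<lambda>n. complex_of_real ((1 - v / 2 / real n) ^ n)"
  let ?err = "\<lambda>n. B ^ 3 / (6 * sqrt (real n)) + \<bar>(\<integral>x. (h x)\<^sup>2 \<partial>Q n) - v\<bar> / 2"
  have v: "0 \<le> v"
    by (rule LIMSEQ_le_const[OF square]) simp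
  have "\<forall>\<^sub>F n in sequentially. v / 4 \<le> real n"
    by (rule filterlim_real_sequentially[unfolded filterlim_at_top, rule_format])
  then have "\<forall>\<^sub>F n in sequentially. norm (?\<phi> n - ?e n) \<le> ?err n"
    using eventually_gt_at_top[of 0] mean
  proof eventually_elim
    case (elim n)
    then show ?case
      using v by (intro prob_space.integral_iexp_scaled_sum_approx[OF Q h bound]) auto
  qed
  moreover have "?err \<longlonglongrightarrow> 0 + \<bar>v - v\<bar> / 2"
  proof (intro tendsto_intros square)
    show "(\<lambda>n. B ^ 3 / (6 * sqrt (real n))) \<longlonglongrightarrow> 0"
      by real_asymp
  qed auto
  then have "?err \<longlonglongrightarrow> 0"
    by (simp only: diff_self abs_zero div_0 add_0_left)
  ultimately have "(\<lambda>n. ?\<phi> n - ?e n) \<longlonglongrightarrow> 0"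
    by (rule Lim_null_comparison)
  moreover have "?e \<longlonglongrightarrow> complex_of_real (exp (- v / 2))"
    using tendsto_exp_limit_sequentially[of "- v / 2"] by (intro tendsto_of_real) simp
  ultimately show ?thesis
    by (rule Lim_transform[rotated])
qed

section \<open>The critical value\<close>

lemma (in real_distribution) less_Inf_cdf_ge:
  assumes "cdf M a < p" "p < 1"
  shows "a < Inf {t. p \<le> cdf M t}"
proof -
  have "((\<lambda>t. cdf M t) \<longlongrightarrow> cdf M a) (at_right a)"
    using cdf_is_right_cont by (simp add: continuous_within)
  then have "\<forall>\<^sub>F t in at_right a. cdf M t < p \<and> a < t"
    using assms(1) by (intro eventually_conj order_tendstoD eventually_at_right_less)
  then obtain b where b: "cdf M b < p" "a < b"
    using eventually_happens'[OF trivial_limit_at_right_real] by blast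
  have "\<forall>\<^sub>F t in at_top. p < cdf M t"
    using cdf_lim_at_top_prob assms(2) by (intro order_tendstoD) auto
  then obtain t where "p < cdf M t"
    by (auto simp: eventually_at_top_linorder)
  moreover have "b \<le> t" if "p \<le> cdf M t" for t
    using cdf_nondecreasing[of t b] b(1) that by linarith
  ultimately have "b \<le> Inf {t. p \<le> cdf M t}"
    by (intro cInf_greatest) (auto intro: less_imp_le)
  then show ?thesis
    using b(2) by simp
qed

lemma (in prob_space)
  fixes f :: "'a \<Rightarrow> real"
  assumes f: "f \<in> borel_measurable M" and i: "i \<in> I"
  shows integrable_PiM_component: "integrable (PiM I (\<lambda>_. M)) (\<lambda>x. f (x i)) \<longleftrightarrow> integrable M f"
    and integral_PiM_component: "(\<integral>x. f (x i) \<partial>PiM I (\<lambda>_. M)) = expectation f"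
proof -
  have component: "distr (PiM I (\<lambda>_. M)) M (\<lambda>x. x i) = M"
    using i by (intro distr_PiM_component prob_space_axioms)
  have "(\<lambda>x. x i) \<in> measurable (PiM I (\<lambda>_. M)) M"
    using i by measurable
  from integrable_distr_eq[OF this f] integral_distr[OF this f]
  show "integrable (PiM I (\<lambda>_. M)) (\<lambda>x. f (x i)) \<longleftrightarrow> integrable M f"
    and "(\<integral>x. f (x i) \<partial>PiM I (\<lambda>_. M)) = expectation f"
    by (simp_all add: component)
qed

lemma measurable_Wvar: "Wvar lam \<in> borel_measurable Zseq"
  unfolding Wvar_def[abs_def] Zseq_def by measurable

lemma AE_Wvar_pos:
  assumes lam: "\<And>k. 0 < lam k" "summable lam"
  shows "AE z in Zseq. 0 < Wvar lam z"
proof -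
  have "integrable std_normal_distribution (\<lambda>z. z\<^sup>2)"
    using integrable_std_normal_distribution_moment[of 2] by (simp add: std_normal_distribution_def)
  then have int: "integrable Zseq (\<lambda>z. (z k)\<^sup>2)" for k
    unfolding Zseq_def by (subst std_normal.integrable_PiM_component) auto
  have integral: "(\<integral>z. (z k)\<^sup>2 \<partial>Zseq) = (\<integral>z. z\<^sup>2 \<partial>std_normal_distribution)" for k
    unfolding Zseq_def by (subst std_normal.integral_PiM_component) auto
  have "AE z in Zseq. summable (\<lambda>k. lam k * (z k)\<^sup>2)"
    using lam int
    by (intro AE_summable_of_summable_integral) (auto simp: integral less_imp_le intro!: summable_mult2)
  moreover have "AE z in Zseq. z 0 \<noteq> 0"
    unfolding Zseq_def
  proof (rule AE_PiM_component)
    show "AE z in std_normal_distribution. z \<noteq> 0"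
      using AE_lborel_singleton[of "0::real"] unfolding std_normal_distribution_def
      by (subst AE_density) auto
  qed (auto intro: std_normal.prob_space_axioms)
  ultimately show ?thesis
  proof eventually_elim
    case (elim z)
    have "0 < lam 0 * (z 0)\<^sup>2"
      using elim(2) lam(1) by simp
    also have "\<dots> = (\<Sum>k\<in>{0}. lam k * (z k)\<^sup>2)"
      by simp
    also have "\<dots> \<le> Wvar lam z"
      unfolding Wvar_def using elim(1) lam(1) by (intro sum_le_suminf) (auto simp: less_imp_le)
    finally show ?case .
  qed
qed

lemma q_w_pos:
  assumes lam: "\<And>k. 0 < lam k" "summable lam" and \<alpha>: "0 < \<alpha>" "\<alpha> < 1"
  shows "0 < q_w lam \<alpha>"
proof -
  interpret Z: prob_space Zseq
    unfolding Zseq_def by (rule prob_space_std_normal_vector)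
  interpret W: real_distribution "distr Zseq borel (Wvar lam)"
    by (intro Z.real_distribution_distr measurable_Wvar)
  have cdf_W: "cdf (distr Zseq borel (Wvar lam)) t = measure Zseq {z \<in> space Zseq. Wvar lam z \<le> t}" for t
    unfolding cdf_def
    by (subst measure_distr[OF measurable_Wvar]) (auto intro!: arg_cong[where f = "measure Zseq"])
  have "cdf (distr Zseq borel (Wvar lam)) 0 = 0"
    unfolding cdf_W using AE_Wvar_pos[OF lam] measurable_Wvar[measurable]
    by (subst Z.prob_Collect_eq_0) (auto simp: not_le)
  then have "0 < Inf {t. 1 - \<alpha> \<le> cdf (distr Zseq borel (Wvar lam)) t}"
    using \<alpha> by (intro W.less_Inf_cdf_ge) auto
  then show ?thesis
    by (simp add: q_w_def cdf_W)
qed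

lemma suminf_ln_div_tendsto_0:
  fixes lam :: "nat \<Rightarrow> real"
  assumes lam: "\<And>k. 0 \<le> lam k" "summable lam"
  shows "((\<lambda>\<tau>. \<Sum>k. ln (1 + \<tau> * lam k) / \<tau>) \<longlongrightarrow> 0) at_top"
proof -
  have "((\<lambda>\<tau>. ln (1 + \<tau> * lam k) / \<tau>) \<longlongrightarrow> 0) at_top" for k
  proof (cases "lam k = 0")
    case False
    then have "0 < lam k"
      using lam(1)[of k] by simp
    then show ?thesis
      by real_asymp
  qed simp
  moreover have "norm (ln (1 + \<tau> * lam k) / \<tau>) \<le> lam k" if "0 < \<tau>" for \<tau> k
    using ln_add_one_self_le_self[of "\<tau> * lam k"] lam(1)[of k] that
    by (simp add: divide_le_eq mult.commute)
  then have "\<forall>\<^sub>F (k, \<tau>) in sequentially \<times>\<^sub>F at_top. norm (ln (1 + \<tau> * lam k) / \<tau>) \<le> lam k"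
    unfolding eventually_prod_filter
    by (intro exI[of _ "\<lambda>_. True"] exI[of _ "\<lambda>\<tau>. 0 < \<tau>"]) (auto simp: eventually_gt_at_top)
  ultimately show ?thesis
    using tannerys_theorem[of "\<lambda>k \<tau>. ln (1 + \<tau> * lam k) / \<tau>" "\<lambda>_. 0" at_top lam] lam(2) by simp
qed

text \<open>The product is the Laplace transform at \<open>\<tau>\<close> of \<open>\<Sum>\<^sub>k\<^sub><\<^sub>N \<lambda>\<^sub>k Z\<^sub>k\<^sup>2\<close> for independent
  standard normal \<open>Z\<^sub>k\<close>.\<close>
lemma exists_exp_le_prod_inverse_sqrt:
  fixes lam :: "nat \<Rightarrow> real"
  assumes lam: "\<And>k. 0 \<le> lam k" "summable lam" and q: "0 < q"
  shows "\<exists>\<tau>>0. \<forall>N. exp (- (\<tau> * q)) \<le> (\<Prod>k<N. 1 / sqrt (1 + 2 * (\<tau> * lam k)))"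
proof -
  have "\<forall>\<^sub>F t in at_top. (\<Sum>k. ln (1 + t * lam k) / t) < q \<and> 0 < t"
    using suminf_ln_div_tendsto_0[OF lam] q
    by (intro eventually_conj order_tendstoD eventually_gt_at_top)
  then obtain t where t: "(\<Sum>k. ln (1 + t * lam k) / t) < q" "0 < t"
    by (auto simp: eventually_at_top_linorder)
  have ln_bounds: "0 \<le> ln (1 + t * lam k)" "ln (1 + t * lam k) / t \<le> lam k" for k
    using ln_add_one_self_le_self[of "t * lam k"] lam(1)[of k] t(2)
    by (simp_all add: divide_le_eq mult.commute)
  have ln_summable: "summable (\<lambda>k. ln (1 + t * lam k) / t)"
    using ln_bounds t(2) by (intro summable_comparison_test[OF _ lam(2)]) auto
  have "exp (- (t / 2 * q)) \<le> (\<Prod>k<N. 1 / sqrt (1 + 2 * (t / 2 * lam k)))" for N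
  proof -
    have "(\<Sum>k<N. ln (1 + t * lam k) / t) \<le> q"
      using sum_le_suminf[OF ln_summable, of "{..<N}"] ln_bounds(1) t by simp
    then have "(\<Sum>k<N. ln (1 + t * lam k) / 2) \<le> t / 2 * q"
      using t(2) by (simp add: sum_divide_distrib[symmetric] divide_le_eq mult.commute)
    then have "exp (- (t / 2 * q)) \<le> exp (- (\<Sum>k<N. ln (1 + t * lam k) / 2))"
      by simp
    also have "\<dots> = (\<Prod>k<N. exp (- (ln (1 + t * lam k) / 2)))"
      by (simp add: exp_sum sum_negf[symmetric])
    also have "\<dots> = (\<Prod>k<N. 1 / sqrt (1 + 2 * (t / 2 * lam k)))"
    proof (intro prod.cong refl)
      fix k
      have "0 < 1 + t * lam k"
        using lam(1)[of k] t(2) by (intro add_pos_nonneg) auto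
      then show "exp (- (ln (1 + t * lam k) / 2)) = 1 / sqrt (1 + 2 * (t / 2 * lam k))"
        by (simp add: exp_minus inverse_eq_divide flip: ln_sqrt)
    qed
    finally show ?thesis .
  qed
  then show ?thesis
    using t(2) by (intro exI[of _ "t / 2"]) auto
qed

section \<open>Polynomially decaying eigenvalues\<close>

lemma bigtheta_inverse_of_Liminf_Limsup:
  fixes f w :: "'a \<Rightarrow> real"
  assumes w: "\<And>x. 0 < w x"
    and lo: "0 < Liminf F (\<lambda>x. ereal (w x * f x))" and hi: "Limsup F (\<lambda>x. ereal (w x * f x)) < \<infinity>"
  shows "f \<in> \<Theta>[F](\<lambda>x. 1 / w x)"
proof -
  obtain b where b: "0 < b" "ereal b < Liminf F (\<lambda>x. ereal (w x * f x))"
    using ereal_dense2[OF lo] by auto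
  obtain B where B: "Limsup F (\<lambda>x. ereal (w x * f x)) < ereal B"
    using ereal_dense2[OF hi] by auto
  have "\<forall>\<^sub>F x in F. b * norm (1 / w x) \<le> norm (f x) \<and> norm (f x) \<le> max B 1 * norm (1 / w x)"
    using less_LiminfD[OF b(2)] Limsup_lessD[OF B]
  proof eventually_elim
    case (elim x)
    then have "0 < w x * f x"
      using b(1) by simp
    then have "0 < f x"
      using w[of x] by (simp add: zero_less_mult_iff)
    then show ?case
      using elim w[of x] by (auto simp: field_simps max_def)
  qed
  then show ?thesis
    using b(1) by (intro bigthetaI'[of b "max B 1"]) auto
qed

lemma summable_of_bigtheta_powr:
  fixes f :: "nat \<Rightarrow> real"
  assumes "f \<in> \<Theta>(\<lambda>k. 1 / real (Suc k) powr p)" "1 < p"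
  shows "summable f"
proof (rule summable_comparison_test_bigo)
  show "f \<in> O(\<lambda>k. 1 / real (Suc k) powr p)"
    using assms(1) by (rule bigthetaD1)
  have "summable (\<lambda>k. real k powr (- p))"
    using assms(2) by (simp add: summable_real_powr_iff)
  then have "summable (\<lambda>k. real (Suc k) powr (- p))"
    by (subst summable_Suc_iff)
  then show "summable (\<lambda>k. norm (1 / real (Suc k) powr p))"
    by (simp add: powr_minus_divide)
qed

lemma bigo_Suc_of_bigtheta_powr:
  fixes f :: "nat \<Rightarrow> real"
  assumes f: "f \<in> \<Theta>(\<lambda>k. 1 / real (Suc k) powr p)"
  shows "f \<in> O(\<lambda>k. f (Suc k))"
proof -
  have "f \<in> O(\<lambda>k. 1 / real (Suc k) powr p)"
    using f by (rule bigthetaD1)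
  also have "(\<lambda>k. 1 / real (Suc k) powr p) \<in> O(\<lambda>k. 1 / real (Suc (Suc k)) powr p)"
    by real_asymp
  also have "(\<lambda>k. 1 / real (Suc (Suc k)) powr p) \<in> O(\<lambda>k. f (Suc k))"
    using landau_theta.compose[OF f filterlim_Suc] by (simp add: bigtheta_sym bigthetaD1)
  finally show ?thesis .
qed

lemma exists_crossing_index:
  fixes f :: "nat \<Rightarrow> real"
  assumes "f \<longlonglongrightarrow> 0" "0 < e" "e \<le> f 0"
  shows "\<exists>m. e \<le> f m \<and> f (Suc m) < e"
proof -
  have "\<forall>\<^sub>F m in sequentially. f m < e"
    using assms by (intro order_tendstoD)
  then obtain m where "f m < e"
    by (auto simp: eventually_sequentially)
  then show ?thesis
    using ex_least_nat_less[of "\<lambda>m. f m < e" m] assms(3) by (auto simp: not_less)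
qed

lemma exists_index_at_scale:
  fixes f :: "nat \<Rightarrow> real" and e :: "'b \<Rightarrow> real"
  assumes f: "\<And>k. 0 < f k" "decseq f" "f \<longlonglongrightarrow> 0" and D: "0 \<le> D" "\<forall>\<^sub>F k in sequentially. f k \<le> D * f (Suc k)"
    and e: "filterlim e (at_right 0) F"
  obtains \<kappa> where "filterlim \<kappa> sequentially F" and "\<forall>\<^sub>F x in F. e x \<le> f (\<kappa> x) \<and> f (\<kappa> x) \<le> D * e x"
proof -
  define \<kappa> where "\<kappa> x = (SOME m. e x \<le> f m \<and> f (Suc m) < e x)" for x
  have \<kappa>: "e x \<le> f (\<kappa> x) \<and> f (Suc (\<kappa> x)) < e x" if "0 < e x" "e x < f 0" for x
    unfolding \<kappa>_def
    by (rule someI_ex, rule exists_crossing_index[OF f(3)]) (use that in auto)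
  have e_pos: "\<forall>\<^sub>F x in F. 0 < e x"
    using e by (auto simp: filterlim_at elim: eventually_mono)
  have e_less: "\<forall>\<^sub>F x in F. e x < f K" for K
    using e f(1)[of K] by (intro order_tendstoD(2)[of e 0]) (auto simp: filterlim_at)
  have \<kappa>_lim: "filterlim \<kappa> sequentially F"
    unfolding filterlim_at_top
  proof
    fix K
    show "\<forall>\<^sub>F x in F. K \<le> \<kappa> x"
      using e_pos e_less[of 0] e_less[of K]
    proof eventually_elim
      case (elim x)
      then have "f (Suc (\<kappa> x)) < f K"
        using \<kappa>[of x] by simp
      then show ?case
        using decseqD[OF f(2), of "Suc (\<kappa> x)" K] by (meson not_less not_less_eq)
    qed
  qed
  have "\<forall>\<^sub>F x in F. e x \<le> f (\<kappa> x) \<and> f (\<kappa> x) \<le> D * e x"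
    using e_pos e_less[of 0] eventually_compose_filterlim[OF D(2) \<kappa>_lim]
  proof eventually_elim
    case (elim x)
    then have "D * f (Suc (\<kappa> x)) \<le> D * e x"
      using \<kappa>[of x] D(1) by (intro mult_left_mono) auto
    then show ?case
      using \<kappa>[of x] elim by simp
  qed
  with \<kappa>_lim show ?thesis
    by (rule that)
qed

section \<open>The MMD test\<close>

locale bounded_eigensystem = P0: prob_space P0 for P0 :: "'a measure" +
  fixes lam :: "nat \<Rightarrow> real" and phi :: "nat \<Rightarrow> 'a \<Rightarrow> real" and C :: real
  assumes phi_meas[measurable]: "\<And>k. phi k \<in> borel_measurable P0"
    and phi_orth: "\<And>j k. (\<integral>x. phi j x * phi k x \<partial>P0) = (if j = k then 1 else 0)"
    and phi_mean: "\<And>k. (\<integral>x. phi k x \<partial>P0) = 0"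
    and C_pos: "0 < C" and phi_bdd: "\<And>k x. x \<in> space P0 \<Longrightarrow> \<bar>phi k x\<bar> \<le> C"
    and lam_pos: "\<And>k. 0 < lam k" and lam_summable: "summable lam"
begin

lemma lam_nonneg: "0 \<le> lam k"
  using lam_pos[of k] by simp

lemma integrable_mult_phi: "integrable P0 f \<Longrightarrow> integrable P0 (\<lambda>x. f x * phi k x)"
  using phi_bdd by (intro integrable_mult_bounded) auto

definition accept_prob :: "real \<Rightarrow> nat \<Rightarrow> 'a measure \<Rightarrow> real" where
  "accept_prob \<alpha> n P =
    measure (iid P n) {x \<in> space (iid P n). V_statistic lam phi n x \<le> q_w lam \<alpha>}"

context
  fixes P :: "'a measure"
  assumes P: "prob_space P" and sets_P: "sets P = sets P0"
begin

interpretation P: prob_space P by (rule P)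

lemma phi_meas_P[measurable]: "phi k \<in> borel_measurable P"
  using phi_meas[of k] by (simp add: measurable_cong_sets[OF sets_P refl])

lemma phi_bdd_P: "x \<in> space P \<Longrightarrow> \<bar>phi k x\<bar> \<le> C"
  using phi_bdd sets_eq_imp_space_eq[OF sets_P] by simp

lemma integrable_phi: "integrable P (phi k)"
  by (rule P.integrable_bounded[OF phi_meas_P phi_bdd_P])

lemma summable_V_statistic_phi:
  "x \<in> space (iid P n) \<Longrightarrow> summable (\<lambda>k. lam k * (scaled_sum (phi k) n x)\<^sup>2)"
  by (rule P.summable_V_statistic[OF lam_nonneg lam_summable phi_meas_P phi_bdd_P])

lemma measurable_V_statistic_phi[measurable]: "V_statistic lam phi n \<in> borel_measurable (iid P n)"
  using P.integrable_V_statistic[OF lam_nonneg lam_summable phi_meas_P phi_bdd_P] by simp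

lemma accept_prob_le_1: "accept_prob \<alpha> n P \<le> 1"
proof -
  interpret sample: prob_space "iid P n" by (intro prob_space_PiM P)
  show ?thesis
    unfolding accept_prob_def by (rule sample.prob_le_1)
qed

lemma mmd_sq_eq_V_statistic:
  assumes "x \<in> space (iid P n)"
  shows "real n * mmd_sq lam phi n x = V_statistic lam phi n x"
proof (cases "n = 0")
  case False
  have "lam k * ((1 / real n) * (\<Sum>i<n. phi k (x i)))\<^sup>2
      = lam k * (scaled_sum (phi k) n x)\<^sup>2 / real n" for k
    using False by (simp add: scaled_sum_def power_divide power2_eq_square[of "real n"])
  then show ?thesis
    using False suminf_divide[OF summable_V_statistic_phi[OF assms], of "real n"]
    by (simp add: mmd_sq_def V_statistic_def)
qed (simp add: V_statistic_def scaled_sum_def)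

lemma integral_T_MMD_eq_accept_prob: "(\<integral>x. 1 - T_MMD lam phi \<alpha> n x \<partial>iid P n) = accept_prob \<alpha> n P"
proof -
  let ?A = "{x \<in> space (iid P n). V_statistic lam phi n x \<le> q_w lam \<alpha>}"
  have "(\<integral>x. 1 - T_MMD lam phi \<alpha> n x \<partial>iid P n) = (\<integral>x. indicator ?A x \<partial>iid P n)"
    by (intro Bochner_Integration.integral_cong refl)
      (auto simp: T_MMD_def mmd_sq_eq_V_statistic split: split_indicator)
  then show ?thesis
    by (simp add: accept_prob_def Int_absorb1)
qed

end

lemmas integrable_phi_P0 = integrable_phi[OF P0.prob_space_axioms refl]

lemma typeII_eq_Sup:
  "typeII P0 lam phi \<alpha> \<Delta> M n = Sup (insert 0 (accept_prob \<alpha> n ` Palt P0 lam phi \<Delta> M))"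
proof -
  have "(\<lambda>P. \<integral>x. 1 - T_MMD lam phi \<alpha> n x \<partial>iid P n) ` Palt P0 lam phi \<Delta> M
      = accept_prob \<alpha> n ` Palt P0 lam phi \<Delta> M"
    by (intro image_cong refl integral_T_MMD_eq_accept_prob) (auto simp: Palt_def)
  then show ?thesis
    by (simp only: typeII_def)
qed

lemma bdd_above_accept_prob: "bdd_above (insert 0 (accept_prob \<alpha> n ` Palt P0 lam phi \<Delta> M))"
  by (rule bdd_aboveI[where M = 1]) (auto simp: Palt_def accept_prob_le_1)

lemma typeII_nonneg: "0 \<le> typeII P0 lam phi \<alpha> \<Delta> M n"
  unfolding typeII_eq_Sup by (rule cSup_upper[OF _ bdd_above_accept_prob]) simp

lemma accept_prob_le_typeII:
  assumes "P \<in> Palt P0 lam phi \<Delta> M"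
  shows "accept_prob \<alpha> n P \<le> typeII P0 lam phi \<alpha> \<Delta> M n"
  unfolding typeII_eq_Sup by (rule cSup_upper[OF _ bdd_above_accept_prob]) (use assms in auto)

lemma typeII_le:
  assumes "0 \<le> c" "\<And>P. P \<in> Palt P0 lam phi \<Delta> M \<Longrightarrow> accept_prob \<alpha> n P \<le> c"
  shows "typeII P0 lam phi \<alpha> \<Delta> M n \<le> c"
  unfolding typeII_eq_Sup by (rule cSup_least) (use assms in auto)

section \<open>Consistency\<close>

lemma accept_prob_le:
  assumes P: "prob_space P" "sets P = sets P0" and A: "0 < A"
    and signal: "2 * (q_w lam \<alpha> + A) \<le> real n * (\<Sum>k. lam k * (\<integral>x. phi k x \<partial>P)\<^sup>2)"
  shows "accept_prob \<alpha> n P \<le> 4 * C\<^sup>2 * suminf lam / A"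
proof -
  interpret P: prob_space P by (rule P)
  interpret sample: prob_space "iid P n" by (intro prob_space_PiM P)
  note phi_P = phi_meas_P[OF P] phi_bdd_P[OF P]
  note [measurable] = phi_P(1)
  define g where "g k x = phi k x - P.expectation (phi k)" for k x
  have g_meas[measurable]: "g k \<in> borel_measurable P" for k
    unfolding g_def by measurable
  have g_bdd: "\<bar>g k x\<bar> \<le> 2 * C" if "x \<in> space P" for k x
    using P.abs_expectation_le[OF phi_P, of k] phi_P(2)[OF that, of k] unfolding g_def by linarith
  have g_mean: "P.expectation (g k) = 0" for k
    unfolding g_def using integrable_phi[OF P] by (simp add: P.prob_space)
  note g_statistic = lam_nonneg lam_summable g_meas g_bdd
  have "A \<le> V_statistic lam g n x"
    if x: "x \<in> space (iid P n)" and accept: "V_statistic lam phi n x \<le> q_w lam \<alpha>" for x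
  proof -
    note summables = summable_V_statistic_phi[OF P x] P.summable_V_statistic[OF g_statistic x]
      P.summable_mult_expectation_square[OF lam_nonneg lam_summable phi_P]
    from V_statistic_shift_le[OF lam_nonneg summables[unfolded g_def]]
    show ?thesis
      using signal accept unfolding g_def[abs_def] by simp
  qed
  then have "accept_prob \<alpha> n P \<le> measure (iid P n) {x \<in> space (iid P n). A \<le> V_statistic lam g n x}"
    unfolding accept_prob_def
    using P.integrable_V_statistic[OF g_statistic] by (intro sample.finite_measure_mono) auto
  also have "\<dots> \<le> (\<integral>x. V_statistic lam g n x \<partial>iid P n) / A"
    using P.V_statistic_nonneg[OF g_statistic] A
    by (intro integral_Markov_inequality_measure[OF _ sets.empty_sets]
        P.integrable_V_statistic[OF g_statistic]) auto
  also have "\<dots> \<le> 4 * C\<^sup>2 * suminf lam / A"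
    using P.integral_V_statistic_le[OF g_statistic, of n] A
    by (intro divide_right_mono) (simp_all add: g_mean power_mult_distrib)
  finally show ?thesis .
qed

lemma integral_phi_eq_coef_udens:
  assumes "P \<in> Palt P0 lam phi \<Delta> M"
  shows "(\<integral>x. phi k x \<partial>P) = coef P0 phi (udens P0 P) k"
proof -
  have P: "prob_space P" "sets P = sets P0" and ac: "absolutely_continuous P0 P"
    using assms by (auto simp: Palt_def)
  interpret P: prob_space P by (rule P)
  have sf: "sigma_finite_measure P" ..
  have "integrable P0 (\<lambda>x. enn2real (RN_deriv P0 P x) * phi k x)"
    using P0.RN_deriv_integrable[OF sf ac P(2) phi_meas, of k] integrable_phi[OF P] by simp
  moreover have "(\<integral>x. phi k x \<partial>P) = (\<integral>x. enn2real (RN_deriv P0 P x) * phi k x \<partial>P0)"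
    by (rule P0.RN_deriv_integral[OF sf ac P(2) phi_meas])
  ultimately show ?thesis
    using integrable_phi_P0
    by (simp add: coef_def udens_def left_diff_distrib phi_mean)
qed

lemma summable_abs_RKHS_coef:
  assumes "in_RKHS P0 lam phi u"
  shows "summable (\<lambda>k. \<bar>coef P0 phi u k\<bar>)"
proof -
  have "summable (\<lambda>k. \<bar>coef P0 phi u k / sqrt (lam k) * sqrt (lam k)\<bar>)"
    using assms lam_nonneg lam_summable
    by (intro summable_abs_mult_of_squares) (simp_all add: in_RKHS_def power_divide)
  moreover have "sqrt (lam k) \<noteq> 0" for k
    using lam_pos[of k] by simp
  ultimately show ?thesis
    by simp
qed

definition eigen_series :: "(nat \<Rightarrow> real) \<Rightarrow> 'a \<Rightarrow> real" where
  "eigen_series a x = (\<Sum>k. a k * phi k x)"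

lemma measurable_eigen_series[measurable]: "eigen_series a \<in> borel_measurable P0"
  unfolding eigen_series_def[abs_def] by measurable

context
  fixes a :: "nat \<Rightarrow> real"
  assumes a: "summable (\<lambda>k. \<bar>a k\<bar>)"
begin

lemma
  assumes f: "integrable P0 f"
  shows integrable_mult_eigen_series: "integrable P0 (\<lambda>x. f x * eigen_series a x)"
    and sums_integral_mult_eigen_series:
      "(\<lambda>k. a k * coef P0 phi f k) sums (\<integral>x. f x * eigen_series a x \<partial>P0)"
proof -
  have meas: "(\<lambda>x. a k * phi k x) \<in> borel_measurable P0" for k
    by measurable
  have bound: "\<bar>a k * phi k x\<bar> \<le> \<bar>a k\<bar> * C" if "x \<in> space P0" for k x
    using phi_bdd[OF that] by (auto simp: abs_mult intro: mult_left_mono)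
  note weierstrass = f meas bound summable_mult2[OF a]
  show "integrable P0 (\<lambda>x. f x * eigen_series a x)"
    unfolding eigen_series_def by (rule integrable_mult_suminf_bounded[OF weierstrass])
  show "(\<lambda>k. a k * coef P0 phi f k) sums (\<integral>x. f x * eigen_series a x \<partial>P0)"
    using sums_integral_mult_bounded[OF weierstrass]
    by (simp add: coef_def eigen_series_def mult.left_commute)
qed

lemma integrable_eigen_series: "integrable P0 (eigen_series a)"
  using integrable_mult_eigen_series[of "\<lambda>_. 1"] by simp

lemma integral_eigen_series: "(\<integral>x. eigen_series a x \<partial>P0) = 0"
  using sums_integral_mult_eigen_series[of "\<lambda>_. 1"] by (simp add: coef_def phi_mean sums_iff)

lemma coef_eigen_series: "coef P0 phi (eigen_series a) j = a j"
proof -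
  have "(\<lambda>k. if k = j then a k else 0) sums (\<integral>x. phi j x * eigen_series a x \<partial>P0)"
    using sums_integral_mult_eigen_series[OF integrable_phi_P0, of j]
    by (simp add: coef_def phi_orth eq_commute[of j] if_distrib[of "\<lambda>x. _ * x"] cong: if_cong)
  then show ?thesis
    using sums_unique2[OF sums_single[of j a]] by (simp add: coef_def mult.commute)
qed

end

end

locale complete_eigensystem = bounded_eigensystem +
  assumes phi_complete: "\<And>f. L2 P0 f \<Longrightarrow> (\<integral>x. f x \<partial>P0) = 0 \<Longrightarrow>
      (\<forall>k. (\<integral>x. f x * phi k x \<partial>P0) = 0) \<Longrightarrow> AE x in P0. f x = 0"
begin

text \<open>The expansion of an RKHS element converges uniformly, so completeness identifies its limit
  without recourse to the Riesz--Fischer theorem.\<close>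
lemma RKHS_AE_eq_eigen_series:
  assumes u: "in_RKHS P0 lam phi u"
  shows "AE x in P0. u x = eigen_series (coef P0 phi u) x"
proof -
  let ?v = "eigen_series (coef P0 phi u)"
  have u_meas[measurable]: "u \<in> borel_measurable P0" and u_square: "integrable P0 (\<lambda>x. (u x)\<^sup>2)"
    and u_mean: "(\<integral>x. u x \<partial>P0) = 0"
    using u by (auto simp: in_RKHS_def L2_def)
  note u_int = P0.square_integrable_imp_integrable[OF u_meas u_square]
  note coef_summable = summable_abs_RKHS_coef[OF u]
  note v_int = integrable_eigen_series[OF coef_summable]
  have "AE x in P0. u x - ?v x = 0"
  proof (rule phi_complete)
    have "(u x - ?v x)\<^sup>2 = (u x)\<^sup>2 - 2 * (u x * ?v x) + ?v x * ?v x" for x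
      by (simp add: power2_eq_square algebra_simps)
    then show "L2 P0 (\<lambda>x. u x - ?v x)"
      using u_square integrable_mult_eigen_series[OF coef_summable u_int]
        integrable_mult_eigen_series[OF coef_summable v_int]
      by (simp add: L2_def)
    show "(\<integral>x. u x - ?v x \<partial>P0) = 0"
      using u_int v_int u_mean integral_eigen_series[OF coef_summable] by simp
    show "\<forall>k. (\<integral>x. (u x - ?v x) * phi k x \<partial>P0) = 0"
      using integrable_mult_phi[OF u_int] integrable_mult_phi[OF v_int]
        coef_eigen_series[OF coef_summable]
      by (simp add: left_diff_distrib flip: coef_def)
  qed
  then show ?thesis
    by simp
qed

lemma RKHS_parseval:
  assumes u: "in_RKHS P0 lam phi u"
  shows "(\<integral>x. (u x)\<^sup>2 \<partial>P0) = (\<Sum>k. (coef P0 phi u k)\<^sup>2)"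
proof -
  have u_meas[measurable]: "u \<in> borel_measurable P0" and u_square: "integrable P0 (\<lambda>x. (u x)\<^sup>2)"
    using u by (auto simp: in_RKHS_def L2_def)
  have "(\<lambda>k. (coef P0 phi u k)\<^sup>2) sums (\<integral>x. u x * eigen_series (coef P0 phi u) x \<partial>P0)"
    using sums_integral_mult_eigen_series[OF summable_abs_RKHS_coef[OF u]
        P0.square_integrable_imp_integrable[OF u_meas u_square]]
    by (simp add: power2_eq_square)
  also have "(\<integral>x. u x * eigen_series (coef P0 phi u) x \<partial>P0) = (\<integral>x. (u x)\<^sup>2 \<partial>P0)"
    using RKHS_AE_eq_eigen_series[OF u] by (intro integral_cong_AE) (auto simp: power2_eq_square)
  finally show ?thesis
    by (rule sums_unique)
qed

lemma F0_square_norm_le: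
  assumes u: "u \<in> F0 P0 lam phi M"
  shows "(\<integral>x. (u x)\<^sup>2 \<partial>P0)\<^sup>2 \<le> M\<^sup>2 * (\<Sum>k. lam k * (coef P0 phi u k)\<^sup>2)"
proof -
  let ?a = "coef P0 phi u"
  have RKHS: "in_RKHS P0 lam phi u" and norm: "(\<Sum>k. (?a k)\<^sup>2 / lam k) \<le> M\<^sup>2"
    using u by (auto simp: F0_def RKHS_norm_def intro: sqrt_le_D)
  then have norm_summable: "summable (\<lambda>k. (?a k)\<^sup>2 / lam k)"
    by (simp add: in_RKHS_def)
  have "lam k * (?a k)\<^sup>2 \<le> (suminf lam)\<^sup>2 * ((?a k)\<^sup>2 / lam k)" for k
  proof -
    have "lam k \<le> suminf lam"
      using sum_le_suminf[OF lam_summable, of "{k}"] lam_nonneg by simp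
    then have "(lam k)\<^sup>2 * ((?a k)\<^sup>2 / lam k) \<le> (suminf lam)\<^sup>2 * ((?a k)\<^sup>2 / lam k)"
      using lam_nonneg[of k] by (intro mult_right_mono power_mono) auto
    then show ?thesis
      using lam_pos[of k] by (simp add: power2_eq_square)
  qed
  then have signal_summable: "summable (\<lambda>k. lam k * (?a k)\<^sup>2)"
    using lam_nonneg by (intro summable_comparison_test[OF _ summable_mult[OF norm_summable]]) auto
  have split: "(sqrt (lam k) * ?a k) * (?a k / sqrt (lam k)) = (?a k)\<^sup>2" for k
    using lam_pos[of k] by (simp add: power2_eq_square)
  have "(\<integral>x. (u x)\<^sup>2 \<partial>P0)\<^sup>2 = (\<Sum>k. (sqrt (lam k) * ?a k) * (?a k / sqrt (lam k)))\<^sup>2"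
    by (simp only: RKHS_parseval[OF RKHS] split)
  also have "\<dots> \<le> (\<Sum>k. (sqrt (lam k) * ?a k)\<^sup>2) * (\<Sum>k. (?a k / sqrt (lam k))\<^sup>2)"
    using signal_summable norm_summable lam_nonneg
    by (intro Cauchy_Schwarz_suminf) (simp_all add: power_mult_distrib power_divide)
  also have "\<dots> = (\<Sum>k. lam k * (?a k)\<^sup>2) * (\<Sum>k. (?a k)\<^sup>2 / lam k)"
    using lam_nonneg by (simp add: power_mult_distrib power_divide)
  also have "\<dots> \<le> (\<Sum>k. lam k * (?a k)\<^sup>2) * M\<^sup>2"
    using norm lam_nonneg by (intro mult_left_mono suminf_nonneg signal_summable) auto
  finally show ?thesis
    by (simp add: mult.commute)
qed

lemma signal_ge:
  assumes P: "P \<in> Palt P0 lam phi \<Delta> M" and M: "0 < M" and \<Delta>: "0 < \<Delta>"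
  shows "\<Delta>\<^sup>2 / M\<^sup>2 \<le> (\<Sum>k. lam k * (\<integral>x. phi k x \<partial>P)\<^sup>2)"
proof -
  have u: "udens P0 P \<in> F0 P0 lam phi M" and "\<Delta> \<le> (\<integral>x. (udens P0 P x)\<^sup>2 \<partial>P0)"
    using P by (auto simp: Palt_def chi2_def)
  then have "\<Delta>\<^sup>2 \<le> (\<integral>x. (udens P0 P x)\<^sup>2 \<partial>P0)\<^sup>2"
    using \<Delta> by (intro power_mono) auto
  also have "\<dots> \<le> M\<^sup>2 * (\<Sum>k. lam k * (\<integral>x. phi k x \<partial>P)\<^sup>2)"
    unfolding integral_phi_eq_coef_udens[OF P] by (rule F0_square_norm_le[OF u])
  finally show ?thesis
    using M by (simp add: divide_le_eq mult.commute)
qed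

lemma typeII_tendsto_0:
  assumes M: "0 < M" and \<Delta>: "\<And>n. 0 < \<Delta> n"
    and separation: "filterlim (\<lambda>n. sqrt (real n) * \<Delta> n) at_top sequentially"
  shows "(\<lambda>n. typeII P0 lam phi \<alpha> (\<Delta> n) M n) \<longlonglongrightarrow> 0"
proof -
  define A where "A n = - q_w lam \<alpha> + 1 / (2 * M\<^sup>2) * (sqrt (real n) * \<Delta> n)\<^sup>2" for n
  define K where "K = 4 * C\<^sup>2 * suminf lam"
  have K: "0 \<le> K"
    unfolding K_def using lam_nonneg lam_summable by (simp add: suminf_nonneg)
  have A_lim: "filterlim A at_top sequentially"
    unfolding A_def[abs_def] using M separation
    by (intro filterlim_tendsto_add_at_top[OF tendsto_const]
        filterlim_tendsto_pos_mult_at_top[OF tendsto_const] filterlim_pow_at_top) auto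
  then have bound_lim: "(\<lambda>n. K / A n) \<longlonglongrightarrow> 0"
    by (rule real_tendsto_divide_at_top[OF tendsto_const])
  have "\<forall>\<^sub>F n in sequentially. 0 < A n"
    using A_lim by (simp add: filterlim_at_top_dense)
  then have "\<forall>\<^sub>F n in sequentially. typeII P0 lam phi \<alpha> (\<Delta> n) M n \<le> K / A n"
  proof eventually_elim
    case (elim n)
    have "accept_prob \<alpha> n P \<le> K / A n" if P: "P \<in> Palt P0 lam phi (\<Delta> n) M" for P
      unfolding K_def
    proof (rule accept_prob_le[OF _ _ elim])
      have "2 * (q_w lam \<alpha> + A n) = real n * ((\<Delta> n)\<^sup>2 / M\<^sup>2)"
        by (simp add: A_def power_mult_distrib)
      also have "\<dots> \<le> real n * (\<Sum>k. lam k * (\<integral>x. phi k x \<partial>P)\<^sup>2)"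
        by (intro mult_left_mono signal_ge[OF P M \<Delta>]) simp
      finally show "2 * (q_w lam \<alpha> + A n) \<le> real n * (\<Sum>k. lam k * (\<integral>x. phi k x \<partial>P)\<^sup>2)" .
    qed (use P in \<open>auto simp: Palt_def\<close>)
    then show ?case
      using elim K by (intro typeII_le) simp_all
  qed
  from tendsto_sandwich[OF _ this tendsto_const bound_lim] show ?thesis
    by (simp add: typeII_nonneg)
qed

end

section \<open>Tilted measures\<close>

definition tilt :: "'a measure \<Rightarrow> ('a \<Rightarrow> real) \<Rightarrow> 'a measure" where
  "tilt M h = density M (\<lambda>x. ennreal (1 + h x))"

lemma sets_tilt[simp, measurable_cong]: "sets (tilt M h) = sets M"
  and space_tilt[simp]: "space (tilt M h) = space M"
  by (simp_all add: tilt_def)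

lemma F0_AE_cong:
  assumes [measurable]: "u \<in> borel_measurable M" "v \<in> borel_measurable M"
    "\<And>k. phi k \<in> borel_measurable M"
    and AE_eq: "AE x in M. u x = v x"
  shows "u \<in> F0 M lam phi R \<longleftrightarrow> v \<in> F0 M lam phi R"
proof -
  have "coef M phi u k = coef M phi v k" for k
    unfolding coef_def using AE_eq by (intro integral_cong_AE) auto
  moreover have "integrable M (\<lambda>x. (u x)\<^sup>2) \<longleftrightarrow> integrable M (\<lambda>x. (v x)\<^sup>2)"
    using AE_eq by (intro integrable_cong_AE) auto
  moreover have "(\<integral>x. u x \<partial>M) = (\<integral>x. v x \<partial>M)"
    using AE_eq by (intro integral_cong_AE) auto
  ultimately show ?thesis
    by (simp add: F0_def in_RKHS_def RKHS_norm_def L2_def)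
qed

context prob_space
begin

context
  fixes h :: "'a \<Rightarrow> real"
  assumes h_int: "integrable M h" and h_ge: "\<And>x. x \<in> space M \<Longrightarrow> - 1 \<le> h x"
begin

lemmas [measurable] = borel_measurable_integrable[OF h_int]

lemma tilt_density_nonneg: "x \<in> space M \<Longrightarrow> 0 \<le> 1 + h x"
  using h_ge[of x] by simp

lemma integral_tilt:
  fixes f :: "'a \<Rightarrow> real"
  assumes f: "integrable M f" "integrable M (\<lambda>x. h x * f x)"
  shows "(\<integral>x. f x \<partial>tilt M h) = expectation f + expectation (\<lambda>x. h x * f x)"
proof -
  have "(\<integral>x. f x \<partial>tilt M h) = expectation (\<lambda>x. (1 + h x) *\<^sub>R f x)"
    unfolding tilt_def using f(1) tilt_density_nonneg by (intro integral_density AE_I2) auto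
  then show ?thesis
    using f by (simp add: distrib_right)
qed

lemma prob_space_tilt:
  assumes "expectation h = 0"
  shows "prob_space (tilt M h)"
proof
  have "(\<integral>\<^sup>+x. ennreal (1 + h x) \<partial>M) = ennreal (expectation (\<lambda>x. 1 + h x))"
    using h_int tilt_density_nonneg by (intro nn_integral_eq_integral AE_I2) auto
  also have "\<dots> = 1"
    using h_int assms by (simp add: prob_space)
  finally show "emeasure (tilt M h) (space (tilt M h)) = 1"
    by (simp add: tilt_def emeasure_density cong: nn_integral_cong)
qed

lemma AE_udens_tilt: "AE x in M. udens M (tilt M h) x = h x"
proof -
  have "AE x in M. ennreal (1 + h x) = RN_deriv M (tilt M h) x"
    by (rule RN_deriv_unique) (auto simp: tilt_def)
  then show ?thesis
    using AE_space
  proof eventually_elim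
    case (elim x)
    then show ?case
      using tilt_density_nonneg[of x] by (simp add: udens_def elim(1)[symmetric])
  qed
qed

end

lemma tilt_in_Palt:
  assumes h: "h \<in> F0 M lam phi R" and h_ge: "\<And>x. x \<in> space M \<Longrightarrow> - 1 \<le> h x"
    and phi: "\<And>k. phi k \<in> borel_measurable M" and \<Delta>: "\<Delta> \<le> expectation (\<lambda>x. (h x)\<^sup>2)"
  shows "tilt M h \<in> Palt M lam phi \<Delta> R"
proof -
  have h_meas[measurable]: "h \<in> borel_measurable M" and h_square_int: "integrable M (\<lambda>x. (h x)\<^sup>2)"
    and h_mean: "expectation h = 0"
    using h by (auto simp: F0_def in_RKHS_def L2_def)
  note h_int = square_integrable_imp_integrable[OF h_meas h_square_int]
  note udens = AE_udens_tilt[OF h_int h_ge]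
  have udens_meas[measurable]: "udens M (tilt M h) \<in> borel_measurable M"
    unfolding udens_def by measurable
  have "chi2 (tilt M h) M = expectation (\<lambda>x. (h x)\<^sup>2)"
    unfolding chi2_def using udens by (intro integral_cong_AE) auto
  moreover have "udens M (tilt M h) \<in> F0 M lam phi R"
    using F0_AE_cong[OF udens_meas h_meas phi udens] h by simp
  moreover have "absolutely_continuous M (tilt M h)"
    unfolding tilt_def by (rule absolutely_continuousI_density) measurable
  ultimately show ?thesis
    using prob_space_tilt[OF h_int h_ge h_mean] \<Delta> by (simp add: Palt_def)
qed

end

section \<open>Spiked alternatives\<close>

context bounded_eigensystem
begin

abbreviation spike :: "real \<Rightarrow> nat \<Rightarrow> 'a measure" where
  "spike a k \<equiv> tilt P0 (\<lambda>x. a * phi k x)"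

lemma scaled_phi_in_F0:
  assumes M: "0 \<le> M" and a: "a\<^sup>2 \<le> M\<^sup>2 * lam k"
  shows "(\<lambda>x. a * phi k x) \<in> F0 P0 lam phi M"
proof -
  have phi_square_int: "integrable P0 (\<lambda>x. (phi k x)\<^sup>2)"
    using integrable_mult_phi[OF integrable_phi_P0, of k k]
    by (simp add: power2_eq_square)
  have "coef P0 phi (\<lambda>x. a * phi k x) j = (if k = j then a else 0)" for j
    by (simp add: coef_def mult.assoc phi_orth)
  then have "(\<lambda>j. (coef P0 phi (\<lambda>x. a * phi k x) j)\<^sup>2 / lam j) = (\<lambda>j. if j = k then a\<^sup>2 / lam j else 0)"
    by auto
  then have norm: "(\<lambda>j. (coef P0 phi (\<lambda>x. a * phi k x) j)\<^sup>2 / lam j) sums (a\<^sup>2 / lam k)"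
    using sums_single[of k "\<lambda>j. a\<^sup>2 / lam j"] by simp
  have "sqrt (a\<^sup>2 / lam k) \<le> M"
    using M a lam_pos[of k] by (intro real_le_lsqrt) (auto simp: divide_le_eq)
  then show ?thesis
    using norm phi_square_int
    by (auto simp: F0_def in_RKHS_def RKHS_norm_def L2_def sums_iff phi_mean power_mult_distrib)
qed

context
  fixes a :: real and k :: nat
  assumes a: "\<bar>a\<bar> * C \<le> 1"
begin

lemma spike_ge: "x \<in> space P0 \<Longrightarrow> - 1 \<le> a * phi k x"
  using mult_left_mono[OF phi_bdd, of x "\<bar>a\<bar>" k] a by (simp add: abs_mult[symmetric] abs_le_iff)

lemma integrable_scaled_phi: "integrable P0 (\<lambda>x. a * phi k x)"
  using integrable_phi_P0 by simp

lemma prob_space_spike: "prob_space (spike a k)"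
  by (rule P0.prob_space_tilt[OF integrable_scaled_phi spike_ge]) (simp_all add: phi_mean)

lemma integral_spike:
  assumes "integrable P0 f"
  shows "(\<integral>x. f x \<partial>spike a k) = (\<integral>x. f x \<partial>P0) + a * (\<integral>x. f x * phi k x \<partial>P0)"
proof -
  have "(\<integral>x. f x \<partial>spike a k) = (\<integral>x. f x \<partial>P0) + (\<integral>x. a * phi k x * f x \<partial>P0)"
    using integrable_mult_phi[OF assms, of k]
    by (intro P0.integral_tilt integrable_scaled_phi spike_ge assms) (simp_all add: mult_ac)
  then show ?thesis
    by (simp add: mult_ac)
qed

lemma integral_spike_phi: "(\<integral>x. phi j x \<partial>spike a k) = (if j = k then a else 0)"
  by (simp add: integral_spike integrable_phi_P0 phi_orth phi_mean)

lemma spike_in_Palt: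
  assumes "0 \<le> M" "a\<^sup>2 \<le> M\<^sup>2 * lam k" "\<Delta> \<le> a\<^sup>2"
  shows "spike a k \<in> Palt P0 lam phi \<Delta> M"
proof (rule P0.tilt_in_Palt[OF scaled_phi_in_F0[OF assms(1,2)] spike_ge phi_meas])
  show "\<Delta> \<le> (\<integral>x. (a * phi k x)\<^sup>2 \<partial>P0)"
    using assms(3) phi_orth[of k k] by (simp add: power_mult_distrib power2_eq_square[of "phi _ _"])
qed

end

definition phi_combination :: "nat set \<Rightarrow> (nat \<Rightarrow> real) \<Rightarrow> 'a \<Rightarrow> real" where
  "phi_combination I b x = (\<Sum>k\<in>I. b k * phi k x)"

lemma measurable_phi_combination[measurable]: "phi_combination I b \<in> borel_measurable P0"
  unfolding phi_combination_def[abs_def] by measurable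

lemma abs_phi_combination_le:
  assumes "x \<in> space P0"
  shows "\<bar>phi_combination I b x\<bar> \<le> (\<Sum>k\<in>I. \<bar>b k\<bar> * C)"
  unfolding phi_combination_def using phi_bdd[OF assms]
  by (intro order_trans[OF sum_abs] sum_mono) (auto simp: abs_mult intro: mult_left_mono)

lemma integrable_phi_combination: "integrable P0 (phi_combination I b)"
  unfolding phi_combination_def[abs_def] using integrable_phi_P0 by simp

lemma integral_phi_combination: "(\<integral>x. phi_combination I b x \<partial>P0) = 0"
  unfolding phi_combination_def using integrable_phi_P0 by (simp add: phi_mean)

lemma integral_phi_combination_mult_phi:
  assumes "finite I"
  shows "(\<integral>x. phi_combination I b x * phi j x \<partial>P0) = (if j \<in> I then b j else 0)"
proof -
  have "(\<integral>x. phi_combination I b x * phi j x \<partial>P0) = (\<Sum>k\<in>I. b k * (if k = j then 1 else 0))"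
    using integrable_mult_phi[OF integrable_phi_P0]
    by (simp add: phi_combination_def sum_distrib_right mult.assoc phi_orth)
  then show ?thesis
    using assms by (simp add: if_distrib[of "\<lambda>x. _ * x"] cong: if_cong)
qed

lemma integral_phi_combination_square:
  assumes "finite I"
  shows "(\<integral>x. (phi_combination I b x)\<^sup>2 \<partial>P0) = (\<Sum>k\<in>I. (b k)\<^sup>2)"
proof -
  have "(phi_combination I b x)\<^sup>2 = (\<Sum>k\<in>I. b k * (phi_combination I b x * phi k x))" for x
    by (simp add: power2_eq_square phi_combination_def[of I b x] sum_distrib_left mult_ac)
  then show ?thesis
    using integrable_mult_phi[OF integrable_phi_combination]
    by (simp add: integral_phi_combination_mult_phi[OF assms] power2_eq_square)
qed

lemma scaled_sum_phi_combination:
  "scaled_sum (phi_combination I b) n x = (\<Sum>k\<in>I. b k * scaled_sum (phi k) n x)"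
  by (simp add: scaled_sum_def phi_combination_def sum.swap[of _ "{..<n}"]
      sum_distrib_left sum_divide_distrib)

context
  fixes a :: "nat \<Rightarrow> real" and \<kappa> :: "nat \<Rightarrow> nat"
  assumes a: "\<And>n. \<bar>a n\<bar> * C \<le> 1" "a \<longlonglongrightarrow> 0" and \<kappa>: "filterlim \<kappa> at_top sequentially"
begin

lemma eventually_integral_spike_combination:
  assumes I: "finite I"
  shows "\<forall>\<^sub>F n in sequentially. (\<integral>x. phi_combination I b x \<partial>spike (a n) (\<kappa> n)) = 0"
proof -
  have "\<forall>\<^sub>F n in sequentially. \<forall>k\<in>I. k < \<kappa> n"
    using eventually_compose_filterlim[OF eventually_gt_at_top \<kappa>] I
    by (intro eventually_ball_finite) auto
  then show ?thesis
  proof eventually_elim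
    case (elim n)
    then have "\<kappa> n \<notin> I"
      by auto
    then show ?case
      by (simp add: integral_spike[OF a(1) integrable_phi_combination] integral_phi_combination
          integral_phi_combination_mult_phi[OF I])
  qed
qed

lemma integral_spike_combination_square_tendsto:
  assumes I: "finite I"
  shows "(\<lambda>n. \<integral>x. (phi_combination I b x)\<^sup>2 \<partial>spike (a n) (\<kappa> n)) \<longlonglongrightarrow> (\<Sum>k\<in>I. (b k)\<^sup>2)"
proof -
  define B where "B = (\<Sum>k\<in>I. \<bar>b k\<bar> * C)"
  let ?h = "phi_combination I b"
  have square_bound: "\<bar>(?h x)\<^sup>2\<bar> \<le> B\<^sup>2" if "x \<in> space P0" for x
    using power_mono[OF abs_phi_combination_le[OF that] abs_ge_zero, of I b 2] by (simp add: B_def)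
  have square_int: "integrable P0 (\<lambda>x. (?h x)\<^sup>2)"
    by (rule P0.integrable_bounded[OF _ square_bound]) measurable
  have "\<bar>\<integral>x. (?h x)\<^sup>2 * phi k x \<partial>P0\<bar> \<le> B\<^sup>2 * C" for k
    using square_bound phi_bdd C_pos
    by (intro P0.abs_expectation_le) (auto simp: abs_mult intro!: mult_mono)
  then have "(\<lambda>n. a n * (\<integral>x. (?h x)\<^sup>2 * phi (\<kappa> n) x \<partial>P0)) \<longlonglongrightarrow> 0"
    using a(2) by (intro lim_null_mult_right_bounded[where B = "B\<^sup>2 * C"]) auto
  then have "(\<lambda>n. (\<Sum>k\<in>I. (b k)\<^sup>2) + a n * (\<integral>x. (?h x)\<^sup>2 * phi (\<kappa> n) x \<partial>P0)) \<longlonglongrightarrow> (\<Sum>k\<in>I. (b k)\<^sup>2) + 0"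
    by (intro tendsto_add tendsto_const)
  then show ?thesis
    by (simp add: integral_spike[OF a(1) square_int] integral_phi_combination_square[OF I])
qed

lemma integral_iexp_spike_tendsto:
  assumes I: "finite I"
  shows "(\<lambda>n. \<integral>x. iexp (\<Sum>k\<in>I. b k * scaled_sum (phi k) n x) \<partial>iid (spike (a n) (\<kappa> n)) n)
    \<longlonglongrightarrow> of_real (exp (- (\<Sum>k\<in>I. (b k)\<^sup>2) / 2))"
  unfolding scaled_sum_phi_combination[symmetric]
proof (rule integral_iexp_scaled_sum_tendsto)
  show "prob_space (spike (a n) (\<kappa> n))" for n
    by (rule prob_space_spike[OF a(1)])
  show "phi_combination I b \<in> borel_measurable (spike (a n) (\<kappa> n))" for n
    by measurable
  show "\<bar>phi_combination I b x\<bar> \<le> (\<Sum>k\<in>I. \<bar>b k\<bar> * C)" if "x \<in> space (spike (a n) (\<kappa> n))" for n x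
    using that by (simp add: abs_phi_combination_le)
qed (rule eventually_integral_spike_combination[OF I] integral_spike_combination_square_tendsto[OF I])+

lemma laplace_spike_tendsto:
  assumes \<tau>: "0 \<le> \<tau>"
  shows "(\<lambda>n. \<integral>x. exp (- (\<tau> * (\<Sum>k<N. lam k * (scaled_sum (phi k) n x)\<^sup>2)))
      \<partial>iid (spike (a n) (\<kappa> n)) n) \<longlonglongrightarrow> (\<Prod>k<N. 1 / sqrt (1 + 2 * (\<tau> * lam k)))"
proof -
  define d where "d k = sqrt (2 * (\<tau> * lam k))" for k
  have d_square: "(d k)\<^sup>2 = 2 * (\<tau> * lam k)" for k
    using \<tau> lam_nonneg[of k] by (simp add: d_def)
  have "(\<lambda>n. \<integral>x. exp (- (\<Sum>k<N. (d k * scaled_sum (phi k) n x)\<^sup>2) / 2)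
      \<partial>iid (spike (a n) (\<kappa> n)) n) \<longlonglongrightarrow> (\<Prod>k<N. 1 / sqrt (1 + 2 * (\<tau> * lam k)))"
  proof (rule laplace_sum_squares_tendsto)
    show "prob_space (iid (spike (a n) (\<kappa> n)) n)" for n
      by (intro prob_space_PiM prob_space_spike[OF a(1)])
    show "(\<lambda>x. d k * scaled_sum (phi k) n x) \<in> borel_measurable (iid (spike (a n) (\<kappa> n)) n)" for n k
      by measurable
    show "(\<lambda>n. \<integral>x. iexp (\<Sum>k<N. b k * (d k * scaled_sum (phi k) n x)) \<partial>iid (spike (a n) (\<kappa> n)) n)
        \<longlonglongrightarrow> of_real (exp (- (\<Sum>k<N. 2 * (\<tau> * lam k) * (b k)\<^sup>2) / 2))" for b
      using integral_iexp_spike_tendsto[of "{..<N}" "\<lambda>k. b k * d k"]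
      by (simp add: power_mult_distrib d_square mult.assoc mult.commute[of "(b _)\<^sup>2"])
  qed (use \<tau> lam_nonneg in auto)
  then show ?thesis
    by (simp add: power_mult_distrib d_square sum_distrib_left sum_divide_distrib mult.assoc)
qed

end

end

section \<open>The lower bound\<close>

context bounded_eigensystem
begin

lemma accept_prob_ge:
  assumes P: "prob_space P" "sets P = sets P0" and \<tau>: "0 \<le> \<tau>"
  shows "(\<integral>x. exp (- (\<tau> * (\<Sum>k<N. lam k * (scaled_sum (phi k) n x)\<^sup>2))) \<partial>iid P n)
      - \<tau> * (C\<^sup>2 * (\<Sum>k. lam (k + N)) + real n * (\<Sum>k. lam (k + N) * (\<integral>x. phi (k + N) x \<partial>P)\<^sup>2))
      - exp (- (\<tau> * q_w lam \<alpha>))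
    \<le> accept_prob \<alpha> n P"
proof -
  interpret P: prob_space P by (rule P)
  interpret sample: prob_space "iid P n" by (intro prob_space_PiM P)
  note [measurable] = phi_meas_P[OF P]
  define head where "head x = (\<Sum>k<N. lam k * (scaled_sum (phi k) n x)\<^sup>2)" for x
  define tail where "tail = V_statistic (\<lambda>k. lam (k + N)) (\<lambda>k. phi (k + N)) n"
  have "summable (\<lambda>k. lam (k + N))"
    using lam_summable by (simp add: summable_iff_shift)
  note tail_statistic = lam_nonneg this phi_meas_P[OF P] phi_bdd_P[OF P]
  have head_meas: "head \<in> borel_measurable (iid P n)"
    unfolding head_def by measurable
  have head_nonneg: "0 \<le> head x" for x
    unfolding head_def using lam_nonneg by (intro sum_nonneg) auto
  have tail_int: "integrable (iid P n) tail"
    unfolding tail_def by (rule P.integrable_V_statistic[OF tail_statistic])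
  have tail_nonneg: "0 \<le> tail x" if "x \<in> space (iid P n)" for x
    unfolding tail_def by (rule P.V_statistic_nonneg[OF tail_statistic that])
  have split: "V_statistic lam phi n x = head x + tail x" if "x \<in> space (iid P n)" for x
    unfolding head_def tail_def by (rule V_statistic_split[OF summable_V_statistic_phi[OF P that]])
  have "sample.expectation (\<lambda>x. exp (- (\<tau> * head x))) - \<tau> * sample.expectation tail
      \<le> sample.expectation (\<lambda>x. exp (- (\<tau> * (head x + tail x))))"
    by (rule sample.laplace_add_ge[OF head_meas tail_int head_nonneg tail_nonneg \<tau>])
  also have "\<dots> = sample.expectation (\<lambda>x. exp (- (\<tau> * V_statistic lam phi n x)))"
    by (intro Bochner_Integration.integral_cong refl) (simp add: split)
  also have "\<dots> \<le> accept_prob \<alpha> n P + exp (- (\<tau> * q_w lam \<alpha>))"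
    using sample.laplace_minus_exp_le_prob[OF measurable_V_statistic_phi[OF P] _ \<tau>]
      P.V_statistic_nonneg[OF lam_nonneg lam_summable phi_meas_P[OF P] phi_bdd_P[OF P]]
    by (simp add: accept_prob_def diff_le_eq)
  finally have "sample.expectation (\<lambda>x. exp (- (\<tau> * head x))) - \<tau> * sample.expectation tail
      \<le> accept_prob \<alpha> n P + exp (- (\<tau> * q_w lam \<alpha>))" .
  moreover have "\<tau> * sample.expectation tail
      \<le> \<tau> * (C\<^sup>2 * (\<Sum>k. lam (k + N)) + real n * (\<Sum>k. lam (k + N) * (\<integral>x. phi (k + N) x \<partial>P)\<^sup>2))"
    unfolding tail_def by (intro mult_left_mono \<tau> P.integral_V_statistic_le[OF tail_statistic])
  ultimately show ?thesis
    unfolding head_def by linarith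
qed

lemma accept_prob_spike_ge:
  assumes a: "\<bar>a\<bar> * C \<le> 1" and j: "N \<le> j" and \<tau>: "0 \<le> \<tau>"
  shows "(\<integral>x. exp (- (\<tau> * (\<Sum>k<N. lam k * (scaled_sum (phi k) n x)\<^sup>2))) \<partial>iid (spike a j) n)
      - \<tau> * (C\<^sup>2 * (\<Sum>k. lam (k + N)) + real n * lam j * a\<^sup>2) - exp (- (\<tau> * q_w lam \<alpha>))
    \<le> accept_prob \<alpha> n (spike a j)"
proof -
  have "(\<lambda>k. lam (k + N) * (\<integral>x. phi (k + N) x \<partial>spike a j)\<^sup>2)
      = (\<lambda>k. if k = j - N then lam j * a\<^sup>2 else 0)"
    using j by (auto simp: integral_spike_phi[OF a] fun_eq_iff)
  then have "(\<Sum>k. lam (k + N) * (\<integral>x. phi (k + N) x \<partial>spike a j)\<^sup>2) = lam j * a\<^sup>2"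
    using sums_single[of "j - N" "\<lambda>_. lam j * a\<^sup>2"] by (simp add: sums_iff)
  then show ?thesis
    using accept_prob_ge[OF prob_space_spike[OF a] sets_tilt \<tau>, of n j N \<alpha>] by (simp add: mult.assoc)
qed

lemma exists_laplace_margin:
  assumes \<alpha>: "0 < \<alpha>" "\<alpha> < 1"
  obtains \<tau> \<eta> N where "0 < \<tau>" "0 < \<eta>" "\<tau> * (C\<^sup>2 * (\<Sum>k. lam (k + N))) \<le> \<eta>"
    and "exp (- (\<tau> * q_w lam \<alpha>)) + 4 * \<eta> \<le> (\<Prod>k<N. 1 / sqrt (1 + 2 * (\<tau> * lam k)))"
proof -
  define q where "q = q_w lam \<alpha>"
  have q: "0 < q"
    unfolding q_def by (rule q_w_pos[OF lam_pos lam_summable \<alpha>])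
  obtain \<tau> where \<tau>: "0 < \<tau>"
    and laplace: "\<And>N. exp (- (\<tau> * (q / 2))) \<le> (\<Prod>k<N. 1 / sqrt (1 + 2 * (\<tau> * lam k)))"
    using exists_exp_le_prod_inverse_sqrt[OF lam_nonneg lam_summable, of "q / 2"] q by auto
  define \<eta> where "\<eta> = (exp (- (\<tau> * (q / 2))) - exp (- (\<tau> * q))) / 4"
  have \<eta>: "0 < \<eta>"
    using \<tau> q by (simp add: \<eta>_def)
  obtain N where "\<bar>\<Sum>k. lam (k + N)\<bar> < \<eta> / (\<tau> * C\<^sup>2)"
    using suminf_exist_split[OF _ lam_summable, of "\<eta> / (\<tau> * C\<^sup>2)"] \<eta> \<tau> C_pos by auto
  then have "\<tau> * (C\<^sup>2 * (\<Sum>k. lam (k + N))) \<le> \<eta>"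
    using \<tau> C_pos by (simp add: field_simps abs_less_iff)
  moreover have "exp (- (\<tau> * q)) + 4 * \<eta> \<le> (\<Prod>k<N. 1 / sqrt (1 + 2 * (\<tau> * lam k)))"
  proof -
    have "4 * \<eta> = exp (- (\<tau> * (q / 2))) - exp (- (\<tau> * q))"
      by (simp add: \<eta>_def)
    then show ?thesis
      using laplace[of N] by linarith
  qed
  ultimately show ?thesis
    using that[OF \<tau> \<eta>] by (simp add: q_def)
qed

lemma accept_prob_weak_spike_ge:
  assumes \<alpha>: "0 < \<alpha>" "\<alpha> < 1"
  obtains \<eta> \<epsilon> where "0 < \<eta>" "0 < \<epsilon>"
    "\<And>a \<kappa>. \<lbrakk>\<And>n. \<bar>a n\<bar> * C \<le> 1; a \<longlonglongrightarrow> 0; filterlim \<kappa> at_top sequentially;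
      \<forall>\<^sub>F n in sequentially. real n * lam (\<kappa> n) * (a n)\<^sup>2 \<le> \<epsilon>\<rbrakk>
      \<Longrightarrow> \<forall>\<^sub>F n in sequentially. \<eta> \<le> accept_prob \<alpha> n (spike (a n) (\<kappa> n))"
proof -
  obtain \<tau> \<eta> N where \<tau>: "0 < \<tau>" and \<eta>: "0 < \<eta>" and tail: "\<tau> * (C\<^sup>2 * (\<Sum>k. lam (k + N))) \<le> \<eta>"
    and margin: "exp (- (\<tau> * q_w lam \<alpha>)) + 4 * \<eta> \<le> (\<Prod>k<N. 1 / sqrt (1 + 2 * (\<tau> * lam k)))"
    by (rule exists_laplace_margin[OF \<alpha>])
  show ?thesis
  proof (rule that[OF \<eta>])
    show "0 < \<eta> / \<tau>"
      using \<eta> \<tau> by simp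
    fix a :: "nat \<Rightarrow> real" and \<kappa> :: "nat \<Rightarrow> nat"
    assume a: "\<And>n. \<bar>a n\<bar> * C \<le> 1" "a \<longlonglongrightarrow> 0" and \<kappa>: "filterlim \<kappa> at_top sequentially"
      and weak: "\<forall>\<^sub>F n in sequentially. real n * lam (\<kappa> n) * (a n)\<^sup>2 \<le> \<eta> / \<tau>"
    let ?L = "\<lambda>n. \<integral>x. exp (- (\<tau> * (\<Sum>k<N. lam k * (scaled_sum (phi k) n x)\<^sup>2)))
      \<partial>iid (spike (a n) (\<kappa> n)) n"
    have "exp (- (\<tau> * q_w lam \<alpha>)) + 3 * \<eta> < (\<Prod>k<N. 1 / sqrt (1 + 2 * (\<tau> * lam k)))"
      using margin \<eta> by linarith
    from order_tendstoD(1)[OF laplace_spike_tendsto[OF a \<kappa> less_imp_le[OF \<tau>]] this]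
    have "\<forall>\<^sub>F n in sequentially. exp (- (\<tau> * q_w lam \<alpha>)) + 3 * \<eta> < ?L n" .
    then show "\<forall>\<^sub>F n in sequentially. \<eta> \<le> accept_prob \<alpha> n (spike (a n) (\<kappa> n))"
      using weak \<kappa>[unfolded filterlim_at_top, rule_format, of N]
    proof eventually_elim
      case (elim n)
      have "\<tau> * (real n * lam (\<kappa> n) * (a n)\<^sup>2) \<le> \<eta>"
        using elim(2) \<tau> by (simp add: field_simps)
      then have "\<tau> * (C\<^sup>2 * (\<Sum>k. lam (k + N)) + real n * lam (\<kappa> n) * (a n)\<^sup>2) \<le> 2 * \<eta>"
        using tail by (simp add: distrib_left)
      then show ?case
        using accept_prob_spike_ge[OF a(1) elim(3) less_imp_le[OF \<tau>], of n n \<alpha>] elim(1) by linarith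
    qed
  qed
qed

definition amplitude :: "real \<Rightarrow> nat \<Rightarrow> real" where
  "amplitude c n = sqrt (c / sqrt (real n))"

lemma amplitude_square: "0 \<le> c \<Longrightarrow> (amplitude c n)\<^sup>2 = c / sqrt (real n)"
  by (simp add: amplitude_def)

lemma amplitude_tendsto_0:
  assumes "0 < c"
  shows "amplitude c \<longlonglongrightarrow> 0"
  unfolding amplitude_def[abs_def] using assms by real_asymp

lemma abs_amplitude_le:
  assumes "0 \<le> c" "c \<le> 1 / C\<^sup>2"
  shows "\<bar>amplitude c n\<bar> * C \<le> 1"
proof -
  have "c / sqrt (real n) \<le> c"
    using assms(1) by (cases "n = 0") (simp_all add: divide_le_eq mult_le_cancel_left1)
  from mult_right_mono[OF this zero_le_power2[of C]] have "(\<bar>amplitude c n\<bar> * C)\<^sup>2 \<le> c * C\<^sup>2"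
    using assms(1) by (simp add: power_mult_distrib amplitude_square)
  also have "\<dots> \<le> 1\<^sup>2"
    using assms(2) C_pos by (simp add: field_simps)
  finally show ?thesis
    by (rule power2_le_imp_le) simp
qed

lemma exists_weak_spikes:
  assumes dec: "decseq lam" and ratio: "lam \<in> O(\<lambda>k. lam (Suc k))" and M: "0 < M" and \<epsilon>: "0 < \<epsilon>"
  obtains c \<kappa> where "0 < c" "c \<le> 1 / C\<^sup>2" "filterlim \<kappa> at_top sequentially"
    and "\<forall>\<^sub>F n in sequentially. c / sqrt (real n) \<le> M\<^sup>2 * lam (\<kappa> n)"
    and "\<forall>\<^sub>F n in sequentially. real n * lam (\<kappa> n) * (amplitude c n)\<^sup>2 \<le> \<epsilon>"
proof -
  obtain D where D: "0 < D" "\<forall>\<^sub>F k in sequentially. lam k \<le> D * lam (Suc k)"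
    using landau_o.bigE[OF ratio] lam_nonneg by (auto simp: abs_of_nonneg)
  define c where "c = min (1 / C\<^sup>2) (M * sqrt (\<epsilon> / D))"
  have c: "0 < c" "c \<le> 1 / C\<^sup>2"
    using C_pos M \<epsilon> D(1) by (simp_all add: c_def)
  have "c\<^sup>2 \<le> (M * sqrt (\<epsilon> / D))\<^sup>2"
    using c(1) by (intro power_mono) (auto simp: c_def)
  then have c_signal: "D * c\<^sup>2 / M\<^sup>2 \<le> \<epsilon>"
    using M D(1) \<epsilon> by (simp add: power_mult_distrib field_simps)
  define e where "e n = c / (M\<^sup>2 * sqrt (real n))" for n
  have "filterlim e (at_right 0) sequentially"
    unfolding e_def[abs_def] using c(1) M by real_asymp
  then obtain \<kappa> where \<kappa>: "filterlim \<kappa> at_top sequentially"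
    and scale: "\<forall>\<^sub>F n in sequentially. e n \<le> lam (\<kappa> n) \<and> lam (\<kappa> n) \<le> D * e n"
    by (rule exists_index_at_scale[OF lam_pos dec summable_LIMSEQ_zero[OF lam_summable]
        less_imp_le[OF D(1)] D(2)])
  have "\<forall>\<^sub>F n in sequentially. c / sqrt (real n) \<le> M\<^sup>2 * lam (\<kappa> n)"
    using scale
  proof eventually_elim
    case (elim n)
    then have "M\<^sup>2 * e n \<le> M\<^sup>2 * lam (\<kappa> n)"
      by (intro mult_left_mono) auto
    then show ?case
      using M by (simp add: e_def)
  qed
  moreover have "\<forall>\<^sub>F n in sequentially. real n * lam (\<kappa> n) * (amplitude c n)\<^sup>2 \<le> \<epsilon>"
    using scale eventually_gt_at_top[of 0]
  proof eventually_elim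
    case (elim n)
    then have "real n * lam (\<kappa> n) * (amplitude c n)\<^sup>2 \<le> real n * (D * e n) * (amplitude c n)\<^sup>2"
      by (intro mult_right_mono mult_left_mono) auto
    also have "\<dots> = D * c\<^sup>2 / M\<^sup>2"
      unfolding amplitude_square[OF less_imp_le[OF c(1)]] e_def
      using elim(2) M by (simp add: field_simps power2_eq_square)
    finally show ?case
      using c_signal by simp
  qed
  ultimately show ?thesis
    by (rule that[OF c \<kappa>])
qed

lemma typeII_liminf_pos:
  assumes dec: "decseq lam" and ratio: "lam \<in> O(\<lambda>k. lam (Suc k))" and M: "0 < M" and \<alpha>: "0 < \<alpha>" "\<alpha> < 1"
  shows "\<exists>c>0. Liminf sequentially (\<lambda>n. ereal (typeII P0 lam phi \<alpha> (c / sqrt (real n)) M n)) > 0"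
proof -
  obtain \<eta> \<epsilon> where \<eta>: "0 < \<eta>" and \<epsilon>: "0 < \<epsilon>"
    and weak_spike: "\<And>a \<kappa>. \<lbrakk>\<And>n. \<bar>a n\<bar> * C \<le> 1; a \<longlonglongrightarrow> 0; filterlim \<kappa> at_top sequentially;
      \<forall>\<^sub>F n in sequentially. real n * lam (\<kappa> n) * (a n)\<^sup>2 \<le> \<epsilon>\<rbrakk>
      \<Longrightarrow> \<forall>\<^sub>F n in sequentially. \<eta> \<le> accept_prob \<alpha> n (spike (a n) (\<kappa> n))"
    using accept_prob_weak_spike_ge[OF \<alpha>] by blast
  obtain c \<kappa> where c: "0 < c" "c \<le> 1 / C\<^sup>2" and \<kappa>: "filterlim \<kappa> at_top sequentially"
    and RKHS_ball: "\<forall>\<^sub>F n in sequentially. c / sqrt (real n) \<le> M\<^sup>2 * lam (\<kappa> n)"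
    and signal: "\<forall>\<^sub>F n in sequentially. real n * lam (\<kappa> n) * (amplitude c n)\<^sup>2 \<le> \<epsilon>"
    by (rule exists_weak_spikes[OF dec ratio M \<epsilon>])
  note amplitude = abs_amplitude_le[OF less_imp_le[OF c(1)] c(2)]
    amplitude_square[OF less_imp_le[OF c(1)]]
  from weak_spike[OF amplitude(1) amplitude_tendsto_0[OF c(1)] \<kappa> signal] RKHS_ball
  have "\<forall>\<^sub>F n in sequentially. ereal \<eta> \<le> ereal (typeII P0 lam phi \<alpha> (c / sqrt (real n)) M n)"
  proof eventually_elim
    case (elim n)
    then have "spike (amplitude c n) (\<kappa> n) \<in> Palt P0 lam phi (c / sqrt (real n)) M"
      using M by (intro spike_in_Palt amplitude(1)) (simp_all add: amplitude(2))
    from accept_prob_le_typeII[OF this] show ?case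
      using elim(1) by (simp add: order_trans)
  qed
  then have "ereal \<eta> \<le> Liminf sequentially (\<lambda>n. ereal (typeII P0 lam phi \<alpha> (c / sqrt (real n)) M n))"
    by (rule Liminf_bounded)
  then show ?thesis
    using \<eta> c(1) by (intro exI[of _ c]) (auto elim: less_le_trans[rotated])
qed

end

theorem theorem1:
  fixes P0 :: "'a measure" and K :: "'a \<Rightarrow> 'a \<Rightarrow> real"
    and lam :: "nat \<Rightarrow> real" and phi :: "nat \<Rightarrow> 'a \<Rightarrow> real"
    and s M \<alpha> :: real
  assumes P0: "prob_space P0"
    and phi_meas: "\<And>k. phi k \<in> borel_measurable P0"
    and phi_orth: "\<And>j k. (\<integral>x. phi j x * phi k x \<partial>P0) = (if j = k then 1 else 0)"
    and phi_mean: "\<And>k. (\<integral>x. phi k x \<partial>P0) = 0"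
    and phi_complete: "\<And>f. L2 P0 f \<Longrightarrow> (\<integral>x. f x \<partial>P0) = 0 \<Longrightarrow>
                          (\<forall>k. (\<integral>x. f x * phi k x \<partial>P0) = 0) \<Longrightarrow> AE x in P0. f x = 0"
    and phi_bdd: "\<exists>C. \<forall>k. \<forall>x\<in>space P0. \<bar>phi k x\<bar> \<le> C"
    and mercer: "\<And>x x'. x \<in> space P0 \<Longrightarrow> x' \<in> space P0 \<Longrightarrow>
                    K x x' = (\<Sum>k. lam k * phi k x * phi k x')"
    and lam_pos: "\<And>k. lam k > 0"
    and lam_decr: "\<And>k. lam (Suc k) < lam k"
    and s: "s > 1/2"
    and decay_lo: "Liminf sequentially (\<lambda>k. ereal (real (Suc k) powr (2 * s) * lam k)) > 0"
    and decay_hi: "Limsup sequentially (\<lambda>k. ereal (real (Suc k) powr (2 * s) * lam k)) < \<infinity>"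
    and M: "M > 0"
    and \<alpha>: "0 < \<alpha>" "\<alpha> < 1"
  shows "(\<forall>\<Delta> :: nat \<Rightarrow> real. (\<forall>n. \<Delta> n > 0) \<longrightarrow>
            filterlim (\<lambda>n. sqrt (real n) * \<Delta> n) at_top sequentially \<longrightarrow>
            (\<lambda>n. typeII P0 lam phi \<alpha> (\<Delta> n) M n) \<longlonglongrightarrow> 0)
       \<and> (\<exists>c0 > 0. Liminf sequentially
              (\<lambda>n. ereal (typeII P0 lam phi \<alpha> (c0 / sqrt (real n)) M n)) > 0)"
proof -
  obtain C where C: "\<And>k x. x \<in> space P0 \<Longrightarrow> \<bar>phi k x\<bar> \<le> C"
    using phi_bdd by blast
  have decay: "lam \<in> \<Theta>(\<lambda>k. 1 / real (Suc k) powr (2 * s))"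
    using decay_lo decay_hi by (intro bigtheta_inverse_of_Liminf_Limsup) auto
  interpret P0: prob_space P0 by (rule P0)
  interpret complete_eigensystem P0 lam phi "max C 1"
  proof
    show "\<bar>phi k x\<bar> \<le> max C 1" if "x \<in> space P0" for k x
      using C[OF that, of k] by simp
    show "summable lam"
      using s by (intro summable_of_bigtheta_powr[OF decay]) simp
  qed (use phi_meas phi_orth phi_mean lam_pos phi_complete in auto)
  have "decseq lam"
    using lam_decr by (intro decseq_SucI less_imp_le)
  then show ?thesis
    using typeII_tendsto_0[OF M] typeII_liminf_pos[OF _ bigo_Suc_of_bigtheta_powr[OF decay] M \<alpha>] by blast
qed

end
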